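(* Let $G$ be a supersolvable group. Let $H$ be a subgroup of $G$ and let $\chi: H\to\mathbb{C}^\times$ be a character of $H$ such that $\mathrm{Ind}_H^G(\chi)$ is Schur irreducible. Then the induced representation $\mathrm{Ind}_H^G(\chi)$ is an irreducible representation of $G$.
   Context: A group $G$ is supersolvable if there is a finite series $1 = N_{k+1} \subseteq N_k \subseteq \cdots \subseteq N_0 = G$ with every $N_i$ normal in $G$ and every quotient $N_i/N_{i+1}$ cyclic (finite or infinite). $G$ is regarded as an abstract (discrete) group. Representations are abstract (possibly infinite dimensional, not necessarily unitary) complex representations; irreducible means nonzero with no proper nonzero invariant subspace (algebraically). A character of a group is a one-dimensional complex representation, i.e. a homomorphism to $\mathbb{C}^\times$. Induction is finite (compact) induction: for a representation $(\rho, W)$ of a subgroup $H\le G$, $\mathrm{Ind}_H^G(\rho)$ is the space of functions $f : G \to W$ with $f(hg) = \rho(h) f(g)$ for all $h \in H$, $g \in G$, and with support contained in a finite union of right cosets $Hx$ of $H$ in $G$, on which $G$ acts by right translation $(g\cdot f)(x) = f(xg)$. A representation $V$ of $G$ is Schur irreducible if $\mathrm{End}_G(V)$ (the space of $G$-linear endomorphisms of $V$) is one-dimensional over $\mathbb{C}$. *)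

theory Defs
  imports
    Complex_Main
    "HOL-Library.Function_Algebras"
    "HOL-Algebra.Elementary_Groups"
begin

text \<open>The factors may be finite or infinite cyclic: the library's \<open>cyclic_group\<close> covers both.\<close>

definition supersolvable :: "('g, 'x) monoid_scheme \<Rightarrow> bool" where
  "supersolvable G \<longleftrightarrow> group G \<and>
     (\<exists>(k::nat) (N :: nat \<Rightarrow> 'g set).
        N 0 = carrier G \<and> N (Suc k) = {\<one>\<^bsub>G\<^esub>} \<and>
        (\<forall>i \<le> Suc k. N i \<lhd> G) \<and>
        (\<forall>i \<le> k. N (Suc i) \<subseteq> N i \<and>
           cyclic_group ((G\<lparr>carrier := N i\<rparr>) Mod N (Suc i))))"

definition pointwise_scale ::
  "(complex \<Rightarrow> 'v \<Rightarrow> 'v) \<Rightarrow> complex \<Rightarrow> ('a \<Rightarrow> 'v) \<Rightarrow> ('a \<Rightarrow> 'v)" where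
  "pointwise_scale s c f = (\<lambda>x. s c (f x))"

text \<open>
  The representation space is a subspace \<open>V\<close> of an ambient complex vector space (the type \<open>'v\<close>
  with scalar multiplication \<open>scale\<close>), of arbitrary dimension.  The values of \<open>\<pi> g\<close> outside
  \<open>V\<close>, and of \<open>\<pi>\<close> outside \<open>carrier G\<close>, are irrelevant.
\<close>

locale group_rep = group G + vector_space scale
  for G :: "('g, 'x) monoid_scheme" (structure)
    and scale :: "complex \<Rightarrow> 'v::ab_group_add \<Rightarrow> 'v" +
  fixes V :: "'v set"
    and \<pi> :: "'g \<Rightarrow> 'v \<Rightarrow> 'v"
  assumes space: "subspace V"
    and closed: "\<lbrakk>g \<in> carrier G; v \<in> V\<rbrakk> \<Longrightarrow> \<pi> g v \<in> V"
    and add: "\<lbrakk>g \<in> carrier G; v \<in> V; w \<in> V\<rbrakk> \<Longrightarrow> \<pi> g (v + w) = \<pi> g v + \<pi> g w"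
    and scale: "\<lbrakk>g \<in> carrier G; v \<in> V\<rbrakk> \<Longrightarrow> \<pi> g (scale c v) = scale c (\<pi> g v)"
    and one: "v \<in> V \<Longrightarrow> \<pi> \<one> v = v"
    and mult: "\<lbrakk>g \<in> carrier G; h \<in> carrier G; v \<in> V\<rbrakk> \<Longrightarrow> \<pi> (g \<otimes> h) v = \<pi> g (\<pi> h v)"

locale irreducible_rep = group_rep +
  assumes nonzero: "V \<noteq> {0}"
    and no_proper_invariant:
      "\<lbrakk>subspace U; U \<subseteq> V; \<And>g u. \<lbrakk>g \<in> carrier G; u \<in> U\<rbrakk> \<Longrightarrow> \<pi> g u \<in> U\<rbrakk> \<Longrightarrow> U = {0} \<or> U = V"

text \<open>
  Endomorphisms of \<open>V\<close> are represented by functions on the ambient type that vanish outside \<open>V\<close>,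
  so that each endomorphism has exactly one representative.
\<close>

definition (in group_rep) End_G :: "('v \<Rightarrow> 'v) set" where
  "End_G = {T. (\<forall>v. v \<notin> V \<longrightarrow> T v = 0) \<and>
               (\<forall>v\<in>V. T v \<in> V) \<and>
               (\<forall>v\<in>V. \<forall>w\<in>V. T (v + w) = T v + T w) \<and>
               (\<forall>c. \<forall>v\<in>V. T (scale c v) = scale c (T v)) \<and>
               (\<forall>g\<in>carrier G. \<forall>v\<in>V. T (\<pi> g v) = \<pi> g (T v))}"

locale schur_irreducible_rep = group_rep +
  assumes dim_End_G: "vector_space.dim (pointwise_scale scale) End_G = 1"

text \<open>
  Finite (compact) induction.  Functions on the group are represented by functions on the type
  \<open>'g\<close> that vanish outside \<open>carrier G\<close>.
\<close>

definition ind_space ::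
  "('g, 'x) monoid_scheme \<Rightarrow> 'g set \<Rightarrow> 'w::zero set \<Rightarrow> ('g \<Rightarrow> 'w \<Rightarrow> 'w) \<Rightarrow> ('g \<Rightarrow> 'w) set" where
  "ind_space G H W \<rho> =
     {f. (\<forall>x. x \<notin> carrier G \<longrightarrow> f x = 0) \<and>
         (\<forall>x\<in>carrier G. f x \<in> W) \<and>
         (\<forall>h\<in>H. \<forall>g\<in>carrier G. f (h \<otimes>\<^bsub>G\<^esub> g) = \<rho> h (f g)) \<and>
         (\<exists>C. C \<subseteq> rcosets\<^bsub>G\<^esub> H \<and> finite C \<and> {x \<in> carrier G. f x \<noteq> 0} \<subseteq> \<Union>C)}"

definition ind_action ::
  "('g, 'x) monoid_scheme \<Rightarrow> 'g \<Rightarrow> ('g \<Rightarrow> 'w::zero) \<Rightarrow> ('g \<Rightarrow> 'w)" where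
  "ind_action G g f = (\<lambda>x. if x \<in> carrier G then f (x \<otimes>\<^bsub>G\<^esub> g) else 0)"

definition complex_units :: "complex monoid" where
  "complex_units = \<lparr>carrier = UNIV - {0}, monoid.mult = (*), one = 1\<rparr>"

text \<open>The one-dimensional representation on \<open>\<complex>\<close> given by a character.\<close>

definition char_action :: "('g \<Rightarrow> complex) \<Rightarrow> 'g \<Rightarrow> complex \<Rightarrow> complex" where
  "char_action \<chi> h z = \<chi> h * z"

lemma vector_space_pointwise_scale:
  assumes "vector_space s"
  shows "vector_space (pointwise_scale s)"
proof -
  interpret vector_space s by fact
  show ?thesis
    by unfold_locales
      (auto simp: pointwise_scale_def fun_eq_iff scale_right_distrib scale_left_distrib)
qed

lemma (in group_rep) subspace_End_G: "module.subspace (pointwise_scale scale) End_G"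
proof -
  interpret P: vector_space "pointwise_scale scale :: complex \<Rightarrow> ('v \<Rightarrow> 'v) \<Rightarrow> _"
    by (rule vector_space_pointwise_scale) (rule vector_space_axioms)
  have \<pi>0: "\<pi> g 0 = 0" if "g \<in> carrier G" for g
    using scale[OF that subspace_0[OF space], of 0] by simp
  have "0 \<in> End_G"
    by (simp add: End_G_def subspace_0[OF space] \<pi>0)
  moreover have "S + T \<in> End_G" if "S \<in> End_G" "T \<in> End_G" for S T
    using that by (simp add: End_G_def add subspace_add[OF space] scale_right_distrib ac_simps)
  moreover have "pointwise_scale scale c T \<in> End_G" if "T \<in> End_G" for c T
    using that
    by (simp add: End_G_def pointwise_scale_def scale subspace_scale[OF space]
        scale_right_distrib mult.commute)
  ultimately show ?thesis
    by (simp add: P.subspace_def)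
qed

lemma group_rep_char:
  assumes "group G" and "subgroup H G" and "\<chi> \<in> hom (G\<lparr>carrier := H\<rparr>) complex_units"
  shows "group_rep (G\<lparr>carrier := H\<rparr>) (*) UNIV (char_action \<chi>)"
proof -
  interpret K: group "G\<lparr>carrier := H\<rparr>"
    using assms by (simp add: subgroup.subgroup_is_group)
  interpret C: vector_space "(*) :: complex \<Rightarrow> complex \<Rightarrow> complex"
    by unfold_locales (auto simp: algebra_simps)
  have m: "\<chi> (g \<otimes>\<^bsub>G\<^esub> h) = \<chi> g * \<chi> h" if "g \<in> H" "h \<in> H" for g h
    using assms(3) that by (auto simp: hom_def complex_units_def)
  have nz: "\<chi> g \<noteq> 0" if "g \<in> H" for g
    using assms(3) that by (auto simp: hom_def complex_units_def)
  have o: "\<one>\<^bsub>G\<^esub> \<in> H" using assms(2) by (rule subgroup.one_closed)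
  have "\<chi> \<one>\<^bsub>G\<^esub> = 1"
    using m[OF o o] nz[OF o] K.l_one[of "\<one>\<^bsub>G\<^esub>"] o by simp
  then have "group_rep_axioms (G\<lparr>carrier := H\<rparr>) (*) UNIV (char_action \<chi>)"
    by (intro group_rep_axioms.intro) (simp_all add: char_action_def distrib_left m C.subspace_UNIV)
  then show ?thesis
    by (rule group_rep.intro[OF K.group_axioms C.vector_space_axioms])
qed

lemma group_rep_ind:
  fixes G :: "('g, 'x) monoid_scheme" and s :: "complex \<Rightarrow> 'w::ab_group_add \<Rightarrow> 'w"
  assumes "group G" and H: "subgroup H G" and rep: "group_rep (G\<lparr>carrier := H\<rparr>) s W \<rho>"
  shows "group_rep G (pointwise_scale s) (ind_space G H W \<rho>) (ind_action G)"
proof -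
  interpret group G by fact
  interpret R: group_rep "G\<lparr>carrier := H\<rparr>" s W \<rho> by fact
  interpret P: vector_space "pointwise_scale s :: complex \<Rightarrow> ('g \<Rightarrow> 'w) \<Rightarrow> _"
    by (rule vector_space_pointwise_scale) (rule R.vector_space_axioms)
  have HG: "H \<subseteq> carrier G" using H by (rule subgroup.subset)
  have \<rho>0: "\<rho> h 0 = 0" if "h \<in> H" for h
    using R.scale[of h 0 0] that R.subspace_0[OF R.space] by simp
  have z: "0 \<in> ind_space G H W \<rho>"
    by (auto simp: ind_space_def \<rho>0 R.subspace_0[OF R.space] intro!: exI[of _ "{}"])
  have a: "f + f' \<in> ind_space G H W \<rho>"
    if f: "f \<in> ind_space G H W \<rho>" and f': "f' \<in> ind_space G H W \<rho>" for f f'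
  proof -
    obtain C where C: "C \<subseteq> rcosets\<^bsub>G\<^esub> H" "finite C" "{x \<in> carrier G. f x \<noteq> 0} \<subseteq> \<Union>C"
      using f by (auto simp: ind_space_def)
    obtain D where D: "D \<subseteq> rcosets\<^bsub>G\<^esub> H" "finite D" "{x \<in> carrier G. f' x \<noteq> 0} \<subseteq> \<Union>D"
      using f' by (auto simp: ind_space_def)
    have "{x \<in> carrier G. (f + f') x \<noteq> 0} \<subseteq> \<Union>(C \<union> D)"
    proof
      fix x assume "x \<in> {x \<in> carrier G. (f + f') x \<noteq> 0}"
      then have "x \<in> {x \<in> carrier G. f x \<noteq> 0} \<or> x \<in> {x \<in> carrier G. f' x \<noteq> 0}"
        by auto
      then show "x \<in> \<Union>(C \<union> D)" using C(3) D(3) by blast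
    qed
    then have "\<exists>C. C \<subseteq> rcosets\<^bsub>G\<^esub> H \<and> finite C \<and> {x \<in> carrier G. (f + f') x \<noteq> 0} \<subseteq> \<Union>C"
      using C D by (intro exI[of _ "C \<union> D"]) auto
    then show ?thesis
      using f f' R.add R.subspace_add[OF R.space] by (simp add: ind_space_def)
  qed
  have sc: "pointwise_scale s c f \<in> ind_space G H W \<rho>" if f: "f \<in> ind_space G H W \<rho>" for c f
  proof -
    obtain C where C: "C \<subseteq> rcosets\<^bsub>G\<^esub> H" "finite C" "{x \<in> carrier G. f x \<noteq> 0} \<subseteq> \<Union>C"
      using f by (auto simp: ind_space_def)
    then have "\<exists>C. C \<subseteq> rcosets\<^bsub>G\<^esub> H \<and> finite C \<and>
        {x \<in> carrier G. pointwise_scale s c f x \<noteq> 0} \<subseteq> \<Union>C"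
      by (intro exI[of _ C]) (auto simp: pointwise_scale_def)
    then show ?thesis
      using f R.scale R.subspace_scale[OF R.space]
      by (simp add: ind_space_def) (simp add: pointwise_scale_def)
  qed
  have act: "ind_action G g f \<in> ind_space G H W \<rho>"
    if g: "g \<in> carrier G" and f: "f \<in> ind_space G H W \<rho>" for g f
  proof -
    obtain C where C: "C \<subseteq> rcosets\<^bsub>G\<^esub> H" "finite C" "{x \<in> carrier G. f x \<noteq> 0} \<subseteq> \<Union>C"
      using f by (auto simp: ind_space_def)
    let ?D = "(\<lambda>M. M #>\<^bsub>G\<^esub> inv\<^bsub>G\<^esub> g) ` C"
    have D: "?D \<subseteq> rcosets\<^bsub>G\<^esub> H"
    proof
      fix M assume "M \<in> ?D"
      then obtain L where L: "L \<in> C" and M: "M = L #>\<^bsub>G\<^esub> inv\<^bsub>G\<^esub> g" by blast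
      obtain a where a: "a \<in> carrier G" "L = H #>\<^bsub>G\<^esub> a"
        using C(1) L by (auto simp: RCOSETS_def)
      have "M = H #>\<^bsub>G\<^esub> (a \<otimes>\<^bsub>G\<^esub> inv\<^bsub>G\<^esub> g)"
        using a g HG by (simp add: M coset_mult_assoc)
      then show "M \<in> rcosets\<^bsub>G\<^esub> H"
        using rcosetsI[OF HG, of "a \<otimes>\<^bsub>G\<^esub> inv\<^bsub>G\<^esub> g"] a g by simp
    qed
    have "x \<in> \<Union>?D" if x: "x \<in> carrier G" and nz: "ind_action G g f x \<noteq> 0" for x
    proof -
      have "f (x \<otimes>\<^bsub>G\<^esub> g) \<noteq> 0" "x \<otimes>\<^bsub>G\<^esub> g \<in> carrier G"
        using x nz g by (auto simp: ind_action_def)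
      then obtain M where M: "M \<in> C" "x \<otimes>\<^bsub>G\<^esub> g \<in> M" using C(3) by blast
      have "x = x \<otimes>\<^bsub>G\<^esub> g \<otimes>\<^bsub>G\<^esub> inv\<^bsub>G\<^esub> g" using x g by (simp add: m_assoc)
      then have "x \<in> M #>\<^bsub>G\<^esub> inv\<^bsub>G\<^esub> g" using M(2) unfolding r_coset_def by blast
      then show ?thesis using M(1) by blast
    qed
    then have "\<exists>C. C \<subseteq> rcosets\<^bsub>G\<^esub> H \<and> finite C \<and>
        {x \<in> carrier G. ind_action G g f x \<noteq> 0} \<subseteq> \<Union>C"
      using D C(2) by (intro exI[of _ ?D]) auto
    moreover have "ind_action G g f (h \<otimes>\<^bsub>G\<^esub> x) = \<rho> h (ind_action G g f x)"
      if "h \<in> H" "x \<in> carrier G" for h x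
    proof -
      have "h \<in> carrier G" using that HG by blast
      then show ?thesis using that g f by (simp add: ind_action_def m_assoc ind_space_def)
    qed
    ultimately show ?thesis
      using f g by (simp add: ind_space_def) (simp add: ind_action_def)
  qed
  have "P.subspace (ind_space G H W \<rho>)"
    using z a sc by (simp add: P.subspace_def)
  moreover have "ind_action G \<one>\<^bsub>G\<^esub> f = f" if "f \<in> ind_space G H W \<rho>" for f
    using that by (auto simp: ind_action_def ind_space_def)
  moreover have "ind_action G (g \<otimes>\<^bsub>G\<^esub> h) f = ind_action G g (ind_action G h f)"
    if "g \<in> carrier G" "h \<in> carrier G" for g h and f :: "'g \<Rightarrow> 'w"
    using that by (simp add: ind_action_def fun_eq_iff m_assoc)
  moreover have "ind_action G g (f + f') = ind_action G g f + ind_action G g f'"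
    for g and f f' :: "'g \<Rightarrow> 'w"
    by (simp add: ind_action_def fun_eq_iff)
  moreover have "ind_action G g (pointwise_scale s c f) = pointwise_scale s c (ind_action G g f)"
    for g c f
    by (simp add: ind_action_def pointwise_scale_def fun_eq_iff)
  ultimately have "group_rep_axioms G (pointwise_scale s) (ind_space G H W \<rho>) (ind_action G)"
    using act by (intro group_rep_axioms.intro)
  then show ?thesis
    by (rule group_rep.intro[OF group_axioms P.vector_space_axioms])
qed

end

theory Submission
  imports Defs
begin

text \<open>
  Let \<open>V\<close> be the induced representation and \<open>delta \<in> V\<close> the function equal to \<open>\<chi>\<close> on \<open>H\<close> and to zero
  elsewhere; \<open>delta\<close> generates \<open>V\<close>, and \<open>H\<close> acts on it by \<open>\<chi>\<close>.  By Frobenius reciprocity every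
  vector of \<open>V\<close> on which \<open>H\<close> acts by \<open>\<chi>\<close> is the image of \<open>delta\<close> under an endomorphism, so Schur
  irreducibility says that these vectors are the multiples of \<open>delta\<close> (\<open>schur_eigenvector\<close>).

  The proof climbs the supersolvable series and shows that the functions supported on \<open>NH\<close>, which
  form the representation of \<open>NH\<close> induced by \<open>\<chi>\<close>, are an irreducible representation of \<open>NH\<close> for
  each term \<open>N\<close>.  For \<open>N = 1\<close> it is one-dimensional.  In the step from \<open>N\<close> to a term \<open>J\<close> with
  \<open>J/N\<close> cyclic, generated by the class of \<open>b\<close>, put \<open>P = NH\<close> and \<open>L = JH\<close>, and let \<open>M\<close> be the group
  of the elements of \<open>P\<close> that commute with \<open>b\<close> modulo \<open>N\<close>.  It is normal in \<open>L\<close>, and has finite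
  index in \<open>P\<close> because a cyclic group has finitely many automorphisms.  Write \<open>V\<^sub>P\<close> and \<open>V\<^sub>L\<close> for
  the functions supported on \<open>P\<close> and \<open>L\<close>.  Since \<open>V\<^sub>P\<close> is irreducible for \<open>P\<close> and generated by
  \<open>delta\<close> under \<open>M\<close>, it contains a simple \<open>M\<close>-subspace (\<open>exists_simple_in_cyclic\<close>), whose
  \<open>L\<close>-translates span \<open>V\<^sub>L\<close>.  Hence \<open>V\<^sub>L\<close> is completely reducible over \<open>M\<close>, and each
  \<open>L\<close>-subspace \<open>U\<close> of \<open>V\<^sub>L\<close> is the image of an \<open>M\<close>-equivariant projection \<open>p\<close>
  (\<open>exists_equivariant_projection\<close>).  There are two cases.

  \<^item> Some power \<open>b\<^sup>l\<close> with \<open>l \<noteq> 0\<close> lies in \<open>P\<close>.  Then \<open>M\<close> has finite index in \<open>L\<close>, and \<open>p\<close> can be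
    averaged to an \<open>L\<close>-equivariant map \<open>q\<close> with image \<open>U\<close> (\<open>exists_average\<close>).  By the eigenvector
    property \<open>q delta\<close> is a multiple of \<open>delta\<close>, so \<open>q\<close> is a scalar, and \<open>U\<close> is trivial or everything.

  \<^item> No such power lies in \<open>P\<close>.  Then \<open>V\<^sub>L\<close> is the direct sum of the translates of \<open>V\<^sub>P\<close> by the
    powers of \<open>b\<close>, and each element of \<open>H\<close> centralizes or inverts \<open>b\<close> modulo \<open>N\<close>.  The group
    \<open>H \<inter> M\<close> acts by \<open>\<chi>\<close> on \<open>p delta\<close> and therefore on each of its components.  A nonzero component
    outside \<open>V\<^sub>P\<close>, symmetrized under \<open>H/(H \<inter> M)\<close>, would be a vector outside \<open>V\<^sub>P\<close> on which \<open>H\<close>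
    acts by \<open>\<chi>\<close>, which does not exist (\<open>eigenvector_supported_P\<close>).  So \<open>p delta\<close> lies in
    \<open>U \<inter> V\<^sub>P\<close>, which is \<open>0\<close> or \<open>V\<^sub>P\<close>.  If it is \<open>V\<^sub>P\<close>, then \<open>U\<close> contains \<open>delta\<close>.  If it is \<open>0\<close>,
    the same argument for the conjugates of \<open>p\<close> by powers of \<open>b\<close> gives \<open>p = 0\<close>, that is \<open>U = 0\<close>.
\<close>

section \<open>Invariant subspaces and complete reducibility\<close>

context group_rep
begin

text \<open>
  Subrepresentations and their simplicity are relative to a subset \<open>K\<close> of the group, since
  one vector space is regarded as a representation of several subgroups at once.
\<close>

definition invariant :: "'g set \<Rightarrow> 'v set \<Rightarrow> bool" where
  "invariant K U \<longleftrightarrow> subspace U \<and> U \<subseteq> V \<and> (\<forall>g\<in>K. \<forall>u\<in>U. \<pi> g u \<in> U)"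

definition simple :: "'g set \<Rightarrow> 'v set \<Rightarrow> bool" where
  "simple K X \<longleftrightarrow> invariant K X \<and> X \<noteq> {0} \<and>
     (\<forall>Y. invariant K Y \<and> Y \<subseteq> X \<longrightarrow> Y = {0} \<or> Y = X)"

text \<open>
  Only the restriction of \<open>p\<close> to \<open>E\<close> matters, and its values may lie anywhere in the ambient space.
\<close>

definition equivariant :: "'g set \<Rightarrow> 'v set \<Rightarrow> ('v \<Rightarrow> 'v) \<Rightarrow> bool" where
  "equivariant K E p \<longleftrightarrow>
     (\<forall>v\<in>E. \<forall>w\<in>E. p (v + w) = p v + p w) \<and>
     (\<forall>c. \<forall>v\<in>E. p (scale c v) = scale c (p v)) \<and>
     (\<forall>g\<in>K. \<forall>v\<in>E. p (\<pi> g v) = \<pi> g (p v))"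

lemma invariantD:
  assumes "invariant K U"
  shows "subspace U" "U \<subseteq> V" "\<And>u. u \<in> U \<Longrightarrow> u \<in> V" "\<And>g u. \<lbrakk>g \<in> K; u \<in> U\<rbrakk> \<Longrightarrow> \<pi> g u \<in> U"
    "0 \<in> U" "\<And>u w. \<lbrakk>u \<in> U; w \<in> U\<rbrakk> \<Longrightarrow> u + w \<in> U" "\<And>u w. \<lbrakk>u \<in> U; w \<in> U\<rbrakk> \<Longrightarrow> u - w \<in> U"
    "\<And>u c. u \<in> U \<Longrightarrow> scale c u \<in> U"
  using assms by (auto simp: invariant_def subspace_0 subspace_add subspace_diff subspace_scale)

lemma rep_zero [simp]: "g \<in> carrier G \<Longrightarrow> \<pi> g 0 = 0"
  using scale[OF _ subspace_0[OF space], of g 0] by simp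

lemma rep_inv:
  assumes "g \<in> carrier G" "v \<in> V"
  shows "\<pi> (inv g) (\<pi> g v) = v" "\<pi> g (\<pi> (inv g) v) = v"
  using assms by (simp_all add: mult[symmetric] one)

lemma rep_conj:
  assumes "g \<in> carrier G" "m \<in> carrier G" "v \<in> V"
  shows "\<pi> m (\<pi> g v) = \<pi> g (\<pi> (inv g \<otimes> m \<otimes> g) v)"
proof -
  have "m \<otimes> g = g \<otimes> (inv g \<otimes> m \<otimes> g)"
    using assms by (simp add: m_assoc[symmetric])
  then show ?thesis
    using assms by (simp add: mult[symmetric])
qed

lemma equivariantD:
  assumes "equivariant K E p"
  shows "\<And>v w. \<lbrakk>v \<in> E; w \<in> E\<rbrakk> \<Longrightarrow> p (v + w) = p v + p w"
    "\<And>v c. v \<in> E \<Longrightarrow> p (scale c v) = scale c (p v)"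
    "\<And>g v. \<lbrakk>g \<in> K; v \<in> E\<rbrakk> \<Longrightarrow> p (\<pi> g v) = \<pi> g (p v)"
  using assms by (auto simp: equivariant_def)

lemma invariant_zero: "K \<subseteq> carrier G \<Longrightarrow> invariant K {0}"
  using subspace_0[OF space] by (auto simp: invariant_def)

lemma invariant_mono: "\<lbrakk>invariant K U; L \<subseteq> K\<rbrakk> \<Longrightarrow> invariant L U"
  by (auto simp: invariant_def)

lemma invariant_Int: "\<lbrakk>invariant K U; invariant K W\<rbrakk> \<Longrightarrow> invariant K (U \<inter> W)"
  by (auto simp: invariant_def subspace_inter)

lemma invariant_Inter:
  assumes "\<And>U. U \<in> \<U> \<Longrightarrow> invariant K U" "invariant K W"
  shows "invariant K (W \<inter> \<Inter>\<U>)"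
proof -
  have "subspace (\<Inter>\<U>)"
    using assms(1) by (intro subspace_Inter) (auto simp: invariant_def)
  then show ?thesis
    using assms by (auto simp: invariant_def subspace_inter)
qed

lemma invariant_sums:
  assumes K: "K \<subseteq> carrier G" and U: "invariant K U" and W: "invariant K W"
  shows "invariant K {u + w | u w. u \<in> U \<and> w \<in> W}" (is "invariant K ?S")
proof -
  have "\<pi> g (u + w) \<in> ?S" if "g \<in> K" "u \<in> U" "w \<in> W" for g u w
    using that K add[of g u w] invariantD[OF U] invariantD[OF W] by fastforce
  moreover have "?S \<subseteq> V"
    using invariantD(3)[OF U] invariantD(3)[OF W] subspace_add[OF space] by auto
  ultimately show ?thesis
    using subspace_sums[OF invariantD(1)[OF U] invariantD(1)[OF W]]
    unfolding invariant_def by auto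
qed

lemma invariant_span:
  assumes K: "K \<subseteq> carrier G" and S: "S \<subseteq> V"
    and cl: "\<And>g s. \<lbrakk>g \<in> K; s \<in> S\<rbrakk> \<Longrightarrow> \<pi> g s \<in> span S"
  shows "invariant K (span S)"
proof -
  have sub: "span S \<subseteq> V"
    using S space by (rule span_minimal)
  have "u \<in> V \<and> \<pi> g u \<in> span S" if g: "g \<in> K" and u: "u \<in> span S" for g u
    using u
  proof (induction rule: span_induct_alt)
    case base
    then show ?case using g K subspace_0[OF space] by (auto simp: span_zero)
  next
    case (step c x y)
    have xy: "x \<in> V" "y \<in> V" "g \<in> carrier G"
      using step(1) conjunct1[OF step(2)] S g K by blast+
    then have cx: "scale c x \<in> V"
      using subspace_scale[OF space] by blast
    have "\<pi> g (scale c x + y) = scale c (\<pi> g x) + \<pi> g y"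
      using xy cx by (simp add: add scale)
    moreover have "scale c (\<pi> g x) + \<pi> g y \<in> span S"
      using conjunct2[OF step(2)] cl[OF g step(1)] by (simp add: span_add span_scale)
    ultimately show ?case
      using subspace_add[OF space cx xy(2)] by simp
  qed
  then show ?thesis
    using sub by (auto simp: invariant_def)
qed

lemma simple_disjoint:
  "\<lbrakk>simple K X; invariant K Y\<rbrakk> \<Longrightarrow> X \<subseteq> Y \<or> X \<inter> Y = {0}"
  using invariant_Int unfolding simple_def by (metis Int_lower1 inf.absorb_iff1)

lemma invariant_Union_chain:
  assumes ne: "\<C> \<noteq> {}" and tot: "\<And>X Y. \<lbrakk>X \<in> \<C>; Y \<in> \<C>\<rbrakk> \<Longrightarrow> X \<subseteq> Y \<or> Y \<subseteq> X"
    and inv: "\<And>X. X \<in> \<C> \<Longrightarrow> invariant K X"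
  shows "invariant K (\<Union>\<C>)"
proof -
  have "subspace (\<Union>\<C>)"
  proof (rule subspaceI)
    show "0 \<in> \<Union>\<C>"
      using ne invariantD(5)[OF inv] by blast
    show "x + y \<in> \<Union>\<C>" if xy: "x \<in> \<Union>\<C>" "y \<in> \<Union>\<C>" for x y
    proof -
      obtain X Y where XY: "x \<in> X" "X \<in> \<C>" "y \<in> Y" "Y \<in> \<C>"
        using xy by (elim UnionE)
      then obtain Z where Z: "x \<in> Z" "y \<in> Z" "Z \<in> \<C>"
        using tot[OF XY(2,4)] by blast
      have "x + y \<in> Z"
        using invariantD(6)[OF inv[OF Z(3)] Z(1,2)] .
      then show ?thesis
        using Z(3) by blast
    qed
    show "scale c x \<in> \<Union>\<C>" if "x \<in> \<Union>\<C>" for c x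
      using that invariantD(8)[OF inv] by (meson UnionE UnionI)
  qed
  then show ?thesis
    using inv unfolding invariant_def by blast
qed

text \<open>
  In a sum of simple subspaces every invariant subspace has an invariant complement: by Zorn's
  lemma some \<open>Y\<close> is maximal among the invariant subspaces meeting \<open>U\<close> only in \<open>0\<close>, and then
  \<open>U + Y\<close> contains every simple summand.  The complement is recorded as a projection onto \<open>U\<close>.
\<close>

proposition exists_equivariant_projection:
  assumes K: "K \<subseteq> carrier G" and E: "invariant K E" and U: "invariant K U" "U \<subseteq> E"
    and simples: "\<And>X. X \<in> \<X> \<Longrightarrow> simple K X \<and> X \<subseteq> E" and span: "E \<subseteq> span (\<Union>\<X>)"
  obtains p where "equivariant K E p" "\<And>v. v \<in> E \<Longrightarrow> p v \<in> U" "\<And>u. u \<in> U \<Longrightarrow> p u = u"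
proof -
  let ?A = "{Y. invariant K Y \<and> Y \<subseteq> E \<and> U \<inter> Y = {0}}"
  have "\<exists>M\<in>?A. \<forall>X\<in>?A. M \<subseteq> X \<longrightarrow> X = M"
  proof (rule subset_Zorn_nonempty)
    have "{0} \<in> ?A"
      using invariant_zero[OF K] invariantD(5)[OF U(1)] invariantD(5)[OF E] by auto
    then show "?A \<noteq> {}" by blast
    fix \<C> assume ne: "\<C> \<noteq> {}" and ch: "subset.chain ?A \<C>"
    have "invariant K (\<Union>\<C>)"
      using ne ch by (intro invariant_Union_chain) (auto simp: subset.chain_def)
    moreover have "U \<inter> \<Union>\<C> = {0}" "\<Union>\<C> \<subseteq> E"
      using ne ch by (auto simp: subset.chain_def)
    ultimately show "\<Union>\<C> \<in> ?A" by simp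
  qed
  then obtain Y where YA: "Y \<in> ?A" and Ymax: "\<forall>X\<in>?A. Y \<subseteq> X \<longrightarrow> X = Y"
    by (elim bexE)
  from YA have Y: "invariant K Y" "Y \<subseteq> E" "U \<inter> Y = {0}"
    by simp_all
  have max: "Z = Y" if "invariant K Z" "Z \<subseteq> E" "U \<inter> Z = {0}" "Y \<subseteq> Z" for Z
    using Ymax that by simp
  let ?S = "{u + y | u y. u \<in> U \<and> y \<in> Y}"
  note invU = invariantD[OF U(1)] and invY = invariantD[OF Y(1)] and invE = invariantD[OF E]
  have S: "invariant K ?S"
    by (rule invariant_sums[OF K U(1) Y(1)])
  have "X \<subseteq> ?S" if X: "X \<in> \<X>" for X
  proof (rule ccontr)
    assume "\<not> X \<subseteq> ?S"
    then have 0: "X \<inter> ?S = {0}"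
      using simple_disjoint S simples[OF X] by blast
    have iX: "invariant K X" and "X \<noteq> {0}"
      using simples[OF X] by (auto simp: simple_def)
    let ?Z = "{y + x | y x. y \<in> Y \<and> x \<in> X}"
    have "U \<inter> ?Z = {0}"
    proof -
      have "y + x = 0" if "y + x \<in> U" "y \<in> Y" "x \<in> X" for x y
      proof -
        have "x = (y + x) + (0 - y)" by simp
        then have "x \<in> ?S"
          using that invY(5,7) by blast
        then have "x = 0" using 0 that by blast
        then show ?thesis using that Y(3) by auto
      qed
      moreover have "0 \<in> ?Z"
        using invY(5) invariantD(5)[OF iX] by force
      ultimately show ?thesis using invU(5) by blast
    qed
    moreover have "invariant K ?Z" by (rule invariant_sums[OF K Y(1) iX])
    moreover have "?Z \<subseteq> E"
    proof clarify
      fix y x assume "y \<in> Y" "x \<in> X"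
      then have "y \<in> E" "x \<in> E" using Y(2) simples[OF X] by blast+
      then show "y + x \<in> E" by (rule invE(6))
    qed
    moreover have "Y \<subseteq> ?Z" using invariantD(5)[OF iX] by force
    ultimately have "?Z = Y" by (intro max)
    moreover have "X \<subseteq> ?Z" using invY(5) by force
    ultimately have "X \<subseteq> Y" by simp
    also have "Y \<subseteq> ?S" using invU(5) by force
    finally have "X \<subseteq> ?S" .
    then show False using \<open>\<not> X \<subseteq> ?S\<close> by blast
  qed
  then have "span (\<Union>\<X>) \<subseteq> ?S"
    using invariantD(1)[OF S] by (intro span_minimal) blast+
  then have dec: "\<exists>u y. v = u + y \<and> u \<in> U \<and> y \<in> Y" if "v \<in> E" for v
    using that span by blast
  have uniq: "u = u'" if "u + y = u' + y'" "u \<in> U" "u' \<in> U" "y \<in> Y" "y' \<in> Y" for u u' y y'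
  proof -
    have "u - u' = y' - y"
      using that(1) by (simp add: algebra_simps)
    then have "u - u' \<in> U \<inter> Y"
      using invU(7)[OF that(2,3)] invY(7)[OF that(5,4)] by simp
    then show ?thesis using Y(3) by simp
  qed
  define p where "p v = (SOME u. u \<in> U \<and> (\<exists>y\<in>Y. v = u + y))" for v
  have p: "p v \<in> U \<and> (\<exists>y\<in>Y. v = p v + y)" if "v \<in> E" for v
    unfolding p_def by (rule someI_ex) (use dec[OF that] in blast)
  have pI: "p (u + y) = u" if "u \<in> U" "y \<in> Y" for u y
  proof -
    have "u + y \<in> E" using that U(2) Y(2) invE(6) by blast
    then show ?thesis using p[of "u + y"] uniq that by metis
  qed
  show ?thesis
  proof
    show "p v \<in> U" if "v \<in> E" for v using p that by blast
    show "p u = u" if "u \<in> U" for u using pI[OF that invY(5)] by simp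
    show "equivariant K E p"
      unfolding equivariant_def
    proof (intro conjI ballI allI)
      fix v w assume "v \<in> E" "w \<in> E"
      then obtain a y b z where v: "v = a + y" "a \<in> U" "y \<in> Y" and w: "w = b + z" "b \<in> U" "z \<in> Y"
        using dec by metis
      have "v + w = (a + b) + (y + z)"
        by (simp add: v w ac_simps)
      then have "p (v + w) = a + b"
        using pI[OF invU(6) invY(6)] v w by metis
      then show "p (v + w) = p v + p w"
        using pI v w by simp
    next
      fix c v assume "v \<in> E"
      then obtain a y where v: "v = a + y" "a \<in> U" "y \<in> Y"
        using dec by metis
      then show "p (scale c v) = scale c (p v)"
        using pI invU(8) invY(8) by (simp add: scale_right_distrib)
    next
      fix g v assume g: "g \<in> K" and "v \<in> E"
      then obtain a y where v: "v = a + y" "a \<in> U" "y \<in> Y"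
        using dec by metis
      have "\<pi> g v = \<pi> g a + \<pi> g y"
        using add[of g a y] g K invU(3) invY(3) v by blast
      then show "p (\<pi> g v) = \<pi> g (p v)"
        using pI invU(4) invY(4) v g by simp
    qed
  qed
qed

lemma invariant_translate:
  assumes K: "K \<subseteq> carrier G" and g: "g \<in> carrier G" and U: "invariant K U"
    and conj: "\<And>m. m \<in> K \<Longrightarrow> inv g \<otimes> m \<otimes> g \<in> K"
  shows "invariant K (\<pi> g ` U)"
proof -
  note invU = invariantD[OF U]
  have "subspace (\<pi> g ` U)"
  proof (rule subspaceI)
    show "0 \<in> \<pi> g ` U" using invU(5) g by (metis rep_zero imageI)
    show "x + y \<in> \<pi> g ` U" if "x \<in> \<pi> g ` U" "y \<in> \<pi> g ` U" for x y
      using that g invU(3,6) by (auto simp: add[symmetric])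
    show "scale c x \<in> \<pi> g ` U" if "x \<in> \<pi> g ` U" for c x
      using that g invU(3,8) by (auto simp: scale[symmetric])
  qed
  moreover have "\<pi> g ` U \<subseteq> V" using closed[OF g] invU(3) by blast
  moreover have "\<pi> m (\<pi> g u) \<in> \<pi> g ` U" if "m \<in> K" "u \<in> U" for m u
    using that K g rep_conj[of g m u] conj invU(3,4) by fastforce
  ultimately show ?thesis by (auto simp: invariant_def)
qed

lemma image_rep_inv:
  assumes "g \<in> carrier G" "U \<subseteq> V"
  shows "\<pi> (inv g) ` \<pi> g ` U = U" "\<pi> g ` \<pi> (inv g) ` U = U"
proof -
  have "\<pi> (inv g) ` \<pi> g ` U = (\<lambda>u. u) ` U"
    unfolding image_image using assms rep_inv by (intro image_cong) auto
  then show "\<pi> (inv g) ` \<pi> g ` U = U" by simp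
  have "\<pi> g ` \<pi> (inv g) ` U = (\<lambda>u. u) ` U"
    unfolding image_image using assms rep_inv by (intro image_cong) auto
  then show "\<pi> g ` \<pi> (inv g) ` U = U" by simp
qed

lemma simple_translate:
  assumes K: "K \<subseteq> carrier G" and g: "g \<in> carrier G" and X: "simple K X"
    and conj: "\<And>m. m \<in> K \<Longrightarrow> inv g \<otimes> m \<otimes> g \<in> K" "\<And>m. m \<in> K \<Longrightarrow> g \<otimes> m \<otimes> inv g \<in> K"
  shows "simple K (\<pi> g ` X)"
proof -
  have iX: "invariant K X" and nX: "X \<noteq> {0}"
    and sX: "\<And>Y. \<lbrakk>invariant K Y; Y \<subseteq> X\<rbrakk> \<Longrightarrow> Y = {0} \<or> Y = X"
    using X by (auto simp: simple_def)
  have XV: "X \<subseteq> V" using iX by (rule invariantD)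
  have "\<pi> g ` X \<noteq> {0}"
  proof
    assume "\<pi> g ` X = {0}"
    then have "\<pi> (inv g) ` \<pi> g ` X = {0}" using g by simp
    then show False using nX image_rep_inv(1)[OF g XV] by simp
  qed
  moreover have "Y = {0} \<or> Y = \<pi> g ` X" if Y: "invariant K Y" "Y \<subseteq> \<pi> g ` X" for Y
  proof -
    have "invariant K (\<pi> (inv g) ` Y)"
      using g conj(2) by (intro invariant_translate[OF K _ Y(1)]) auto
    moreover have "\<pi> (inv g) ` Y \<subseteq> X"
      using image_mono[OF Y(2), of "\<pi> (inv g)"] image_rep_inv(1)[OF g XV] by simp
    ultimately have "\<pi> (inv g) ` Y = {0} \<or> \<pi> (inv g) ` Y = X" by (rule sX)
    then show ?thesis
      using image_rep_inv(2)[OF g invariantD(2)[OF Y(1)]] g by auto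
  qed
  ultimately show ?thesis
    using invariant_translate[OF K g iX conj(1)] unfolding simple_def by blast
qed

text \<open>
  Part of Clifford's theorem: a simple subspace for \<open>P\<close> contains a simple subspace for a normal
  subgroup \<open>M\<close> of finite index.  In infinite dimension the existence of a simple subspace is not
  automatic.  Generation by the single vector \<open>v\<close> gives, by Zorn's lemma, a maximal proper invariant
  subspace \<open>Y\<close>, and a simple subspace is then found among the intersections of translates of \<open>Y\<close>,
  of which there are finitely many.  Finite index is expressed, here and below, by a finite set
  \<open>R\<close> of representatives meeting every left coset.
\<close>

proposition exists_simple_in_cyclic:
  assumes P: "subgroup P G" and M: "subgroup M G" "M \<subseteq> P"
    and norm: "\<And>g m. \<lbrakk>g \<in> P; m \<in> M\<rbrakk> \<Longrightarrow> inv g \<otimes> m \<otimes> g \<in> M"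
    and R: "finite R" "R \<subseteq> P" "\<And>g. g \<in> P \<Longrightarrow> \<exists>r\<in>R. \<exists>m\<in>M. g = r \<otimes> m"
    and W: "simple P W" and v: "v \<in> W" and cyc: "\<And>Y. \<lbrakk>invariant M Y; v \<in> Y\<rbrakk> \<Longrightarrow> W \<subseteq> Y"
  obtains X where "simple M X" "X \<subseteq> W"
proof -
  have Pc: "P \<subseteq> carrier G" and Mc: "M \<subseteq> carrier G"
    using P M(1) by (simp_all add: subgroup.subset)
  have iW: "invariant P W" and W0: "W \<noteq> {0}"
    and sW: "\<And>Y. \<lbrakk>invariant P Y; Y \<subseteq> W\<rbrakk> \<Longrightarrow> Y = {0} \<or> Y = W"
    using W by (auto simp: simple_def)
  have iMW: "invariant M W"
    using iW M(2) by (rule invariant_mono)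
  have WV: "W \<subseteq> V" using iW by (rule invariantD)
  have v0: "v \<noteq> 0"
    using cyc[OF invariant_zero[OF Mc]] W0 invariantD(5)[OF iW] by blast
  let ?A = "{Y. invariant M Y \<and> Y \<subseteq> W \<and> v \<notin> Y}"
  have "\<exists>Y\<in>?A. \<forall>Z\<in>?A. Y \<subseteq> Z \<longrightarrow> Z = Y"
  proof (rule subset_Zorn_nonempty)
    have "{0} \<in> ?A"
      using v0 invariant_zero[OF Mc] invariantD(5)[OF iW] by simp
    then show "?A \<noteq> {}" by (metis empty_iff)
    fix \<C> assume ne: "\<C> \<noteq> {}" and ch: "subset.chain ?A \<C>"
    have "invariant M (\<Union>\<C>)"
      using ne ch by (intro invariant_Union_chain) (auto simp: subset.chain_def)
    moreover have "v \<notin> \<Union>\<C>" "\<Union>\<C> \<subseteq> W"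
      using ch by (auto simp: subset.chain_def)
    ultimately show "\<Union>\<C> \<in> ?A" by simp
  qed
  then obtain Y where YA: "Y \<in> ?A" and Ymax: "\<forall>Z\<in>?A. Y \<subseteq> Z \<longrightarrow> Z = Y"
    by (elim bexE)
  from YA have iY: "invariant M Y" and YW: "Y \<subseteq> W" and vY: "v \<notin> Y"
    by simp_all
  have max: "Z = Y \<or> Z = W" if "invariant M Z" "Y \<subseteq> Z" "Z \<subseteq> W" for Z
    using Ymax that cyc[of Z] by (cases "v \<in> Z") auto
  have YV: "Y \<subseteq> V" using YW WV by simp
  have gc: "g \<in> carrier G" "inv g \<in> P" if "g \<in> P" for g
    using that Pc P by (auto simp: subgroup.m_inv_closed)
  have le: "\<pi> g ` W \<subseteq> W" if "g \<in> P" for g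
    using invariantD(4)[OF iW that] by blast
  have gW: "\<pi> g ` W = W" if g: "g \<in> P" for g
  proof
    show "\<pi> g ` W \<subseteq> W" by (rule le[OF g])
    have "\<pi> g ` \<pi> (inv g) ` W \<subseteq> \<pi> g ` W"
      using le[OF gc(2)[OF g]] by (rule image_mono)
    then show "W \<subseteq> \<pi> g ` W"
      using image_rep_inv(2)[OF gc(1)[OF g] WV] by simp
  qed
  have iT: "invariant M (\<pi> g ` Y)" if g: "g \<in> P" for g
    using norm[OF g] gc(1)[OF g] by (intro invariant_translate[OF Mc _ iY])
  have maxT: "Z = \<pi> g ` Y \<or> Z = W" if g: "g \<in> P" and Z: "invariant M Z" "\<pi> g ` Y \<subseteq> Z" "Z \<subseteq> W" for g Z
  proof -
    have "invariant M (\<pi> (inv g) ` Z)"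
      using norm[OF gc(2)[OF g]] gc(1)[OF g] by (intro invariant_translate[OF Mc _ Z(1)]) auto
    moreover have "Y \<subseteq> \<pi> (inv g) ` Z"
      using image_mono[OF Z(2), of "\<pi> (inv g)"] image_rep_inv(1)[OF gc(1)[OF g] YV] by simp
    moreover have "\<pi> (inv g) ` Z \<subseteq> W"
      using image_mono[OF Z(3), of "\<pi> (inv g)"] gW[OF gc(2)[OF g]] by simp
    ultimately have "\<pi> (inv g) ` Z = Y \<or> \<pi> (inv g) ` Z = W"
      by (rule max)
    then show ?thesis
      using image_rep_inv(2)[OF gc(1)[OF g] subset_trans[OF Z(3) WV]] gW[OF g] by auto
  qed
  let ?T = "(\<lambda>g. \<pi> g ` Y) ` P"
  have "?T \<subseteq> (\<lambda>r. \<pi> r ` Y) ` R"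
  proof clarify
    fix g assume "g \<in> P"
    then obtain r m where rm: "r \<in> R" "m \<in> M" "g = r \<otimes> m" using R(3) by blast
    have mc: "m \<in> carrier G" "inv m \<in> M" and rc: "r \<in> carrier G"
      using rm R(2) Pc Mc M(1) by (auto simp: subgroup.m_inv_closed)
    have "\<pi> m ` Y \<subseteq> Y" "\<pi> (inv m) ` Y \<subseteq> Y"
      using invariantD(4)[OF iY] rm(2) mc by blast+
    then have "\<pi> m ` Y = Y"
      using image_rep_inv(2)[OF mc(1) YV] image_mono[of "\<pi> (inv m) ` Y" Y "\<pi> m"] by simp
    moreover have "\<pi> g ` Y = \<pi> r ` \<pi> m ` Y"
      unfolding image_image rm(3) using rc mc YV by (intro image_cong) (auto simp: mult)
    ultimately show "\<pi> g ` Y \<in> (\<lambda>r. \<pi> r ` Y) ` R"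
      using rm(1) by simp
  qed
  then have finT: "finite ?T"
    by (rule finite_subset) (simp add: R(1))
  have "W \<inter> \<Inter>?T = {0} \<or> W \<inter> \<Inter>?T = W"
  proof (rule sW)
    have "subspace (W \<inter> \<Inter>?T)"
      using invariantD(1)[OF invariant_Inter[OF _ iMW, of ?T]] iT by blast
    moreover have "\<pi> h u \<in> \<pi> g ` Y" if h: "h \<in> P" and u: "u \<in> W \<inter> \<Inter>?T" and g: "g \<in> P" for h u g
    proof -
      have "inv h \<otimes> g \<in> P" using g gc(2)[OF h] P by (simp add: subgroup.m_closed)
      then obtain y where y: "y \<in> Y" "u = \<pi> (inv h \<otimes> g) y" using u by blast
      then have "\<pi> h u = \<pi> g y"
        using gc(1)[OF h] gc(1)[OF g] YV by (auto simp: mult[symmetric] m_assoc[symmetric])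
      then show ?thesis using y(1) by blast
    qed
    then have "\<pi> h u \<in> W \<inter> \<Inter>?T" if "h \<in> P" "u \<in> W \<inter> \<Inter>?T" for h u
      using that invariantD(4)[OF iW that(1)] by simp
    ultimately show "invariant P (W \<inter> \<Inter>?T)"
      unfolding invariant_def using le_infI1[OF WV] by simp
  qed simp
  moreover have "v \<notin> \<Inter>?T"
  proof -
    have "\<pi> \<one> ` Y = (\<lambda>u. u) ` Y" using YV by (intro image_cong) (auto simp: one)
    then have "Y \<in> ?T" using subgroup.one_closed[OF P] by (metis image_ident image_eqI)
    then show ?thesis using vY by blast
  qed
  ultimately have Int0: "W \<inter> \<Inter>?T = {0}"
    using v by blast
  \<comment> \<open>If \<open>S\<close> is a maximal set of translates of \<open>Y\<close> with nonzero intersection, that intersection is simple.\<close>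
  let ?B = "{S. S \<subseteq> ?T \<and> W \<inter> \<Inter>S \<noteq> {0}}"
  have "finite ?B" "?B \<noteq> {}"
    using finT W0 by (auto intro: finite_subset[of _ "Pow ?T"] exI[of _ "{}"])
  from finite_has_maximal[OF this]
  obtain S where SB: "S \<in> ?B" and Smax: "\<forall>S'\<in>?B. S \<subseteq> S' \<longrightarrow> S = S'"
    by (elim bexE)
  define X where "X = W \<inter> \<Inter>S"
  have S: "S \<subseteq> ?T" "X \<noteq> {0}" using SB by (simp_all add: X_def)
  have iX: "invariant M X"
    unfolding X_def by (rule invariant_Inter[OF _ iMW]) (use S(1) iT in blast)
  have XW: "X \<subseteq> W" by (simp add: X_def)
  have "S \<noteq> ?T" using SB Int0 by blast
  then obtain T where T: "T \<in> ?T" "T \<notin> S" using S(1) by blast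
  have "W \<inter> \<Inter>(insert T S) = {0}"
  proof (rule ccontr)
    assume "W \<inter> \<Inter>(insert T S) \<noteq> {0}"
    then have "insert T S \<in> ?B"
      using insert_subsetI[OF T(1) S(1)] by (intro CollectI conjI)
    then have "S = insert T S"
      by (rule mp[OF bspec[OF Smax] subset_insertI])
    then have "T \<in> S" using insertI1[of T S] by (rule ssubst)
    then show False using T(2) by (rule notE[rotated])
  qed
  then have XT: "X \<inter> T = {0}" by (simp add: X_def Int_ac)
  obtain g where g: "g \<in> P" "T = \<pi> g ` Y" using T(1) by (elim imageE)
  have iT': "invariant M T" and TW: "T \<subseteq> W"
    using iT[OF g(1)] image_mono[OF YW, of "\<pi> g"] gW[OF g(1)] g(2) by simp_all
  have "Z = {0} \<or> Z = X" if Z: "invariant M Z" "Z \<subseteq> X" for Z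
  proof (cases "Z = {0}")
    case False
    let ?Q = "{t + z | t z. t \<in> T \<and> z \<in> Z}"
    have "\<not> Z \<subseteq> T"
    proof
      assume "Z \<subseteq> T"
      then have "Z \<subseteq> {0}" using Z(2) XT by (metis le_inf_iff)
      then show False using False invariantD(5)[OF Z(1)] by (metis subset_singletonD empty_iff)
    qed
    moreover have "Z \<subseteq> ?Q" using invariantD(5)[OF iT'] by force
    ultimately have "?Q \<noteq> T" by metis
    moreover have "?Q = T \<or> ?Q = W"
    proof (rule maxT[OF g(1), folded g(2)])
      show "invariant M ?Q" by (rule invariant_sums[OF Mc iT' Z(1)])
      show "T \<subseteq> ?Q" using invariantD(5)[OF Z(1)] by force
      show "?Q \<subseteq> W"
      proof clarify
        fix t z assume "t \<in> T" "z \<in> Z"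
        then have "t \<in> W" "z \<in> W" using TW XW Z(2) by (meson subsetD)+
        then show "t + z \<in> W" by (rule invariantD(6)[OF iW])
      qed
    qed
    ultimately have Q: "?Q = W" by metis
    have "y \<in> Z" if y: "y \<in> X" for y
    proof -
      obtain t z where tz: "y = t + z" "t \<in> T" "z \<in> Z" using subsetD[OF XW y] unfolding Q[symmetric] by blast
      then have "t = y - z" by simp
      then have "t \<in> X" using invariantD(7)[OF iX y subsetD[OF Z(2) tz(3)]] by simp
      then have "t \<in> X \<inter> T" using tz(2) by simp
      then have "t = 0" unfolding XT by simp
      then show ?thesis using tz by simp
    qed
    then have "X \<subseteq> Z" by (rule subsetI)
    then show ?thesis using Z(2) by simp
  qed simp
  then have "simple M X" using iX S(2) unfolding simple_def by simp
  then show thesis using XW by (rule that)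
qed

lemma rep_sum:
  assumes "finite I" "g \<in> carrier G" "\<And>i. i \<in> I \<Longrightarrow> f i \<in> V"
  shows "\<pi> g (\<Sum>i\<in>I. f i) = (\<Sum>i\<in>I. \<pi> g (f i))"
  using assms
proof (induction I)
  case (insert i I)
  have "(\<Sum>i\<in>I. f i) \<in> V" using insert by (intro subspace_sum[OF space]) auto
  then show ?case using insert by (simp add: add)
qed simp

text \<open>
  Maschke's averaging over the cosets of a subgroup of finite index; the sum runs over the
  distinct conjugates of \<open>p\<close>, which makes a choice of coset representatives unnecessary.
\<close>

proposition exists_average:
  assumes P: "subgroup P G" and M: "M \<subseteq> P"
    and R: "finite R" "R \<subseteq> P" "\<And>g. g \<in> P \<Longrightarrow> \<exists>r\<in>R. \<exists>m\<in>M. g = r \<otimes> m"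
    and E: "invariant P E" and U: "invariant P U" "U \<subseteq> E"
    and p: "equivariant M E p" "\<And>v. v \<in> E \<Longrightarrow> p v \<in> U" "\<And>u. u \<in> U \<Longrightarrow> p u = u"
  obtains q and n :: nat where "n \<noteq> 0" "equivariant P E q" "\<And>v. v \<in> E \<Longrightarrow> q v \<in> U"
    "\<And>u. u \<in> U \<Longrightarrow> q u = scale (of_nat n) u"
proof -
  define \<tau> where "\<tau> g = (\<lambda>v. if v \<in> E then \<pi> g (p (\<pi> (inv g) v)) else 0)" for g
  define \<T> where "\<T> = \<tau> ` P"
  have gc: "g \<in> carrier G" "inv g \<in> P" if "g \<in> P" for g
    using that P by (auto simp: subgroup.m_inv_closed subgroup.mem_carrier)
  note gE = invariantD(4)[OF E] and gU = invariantD(4)[OF U(1)]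
  have EV: "v \<in> V" if "v \<in> E" for v using invariantD(3)[OF E that] .
  have UV: "v \<in> V" if "v \<in> U" for v using invariantD(3)[OF U(1) that] .
  have \<tau>U: "\<tau> g v \<in> U" if "g \<in> P" "v \<in> E" for g v
    using that gU[OF that(1) p(2)[OF gE[OF gc(2)[OF that(1)] that(2)]]] by (simp add: \<tau>_def)
  have "\<T> \<subseteq> \<tau> ` R"
    unfolding \<T>_def
  proof clarify
    fix g assume "g \<in> P"
    then obtain r m where rm: "r \<in> R" "m \<in> M" "g = r \<otimes> m" using R(3) by blast
    have rP: "r \<in> P" and mP: "m \<in> P" using rm R(2) M by auto
    note c = gc(1)[OF rP] gc(1)[OF mP]
    have "\<tau> g v = \<tau> r v" for v
    proof (cases "v \<in> E")
      case v: True
      define w where "w = \<pi> (inv r) v"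
      have w: "w \<in> E" "\<pi> (inv m) w \<in> E"
        using v gE gc(2)[OF rP] gc(2)[OF mP] by (auto simp: w_def)
      have "\<pi> (inv g) v = \<pi> (inv m) w"
        using c v EV by (simp add: rm(3) w_def inv_mult_group mult)
      moreover have "\<pi> m (p (\<pi> (inv m) w)) = p w"
        using equivariantD(3)[OF p(1) rm(2) w(2)] rep_inv(2)[OF c(2) EV[OF w(1)]] by simp
      moreover have "p (\<pi> (inv m) w) \<in> V" using w(2) p(2) UV by blast
      ultimately show ?thesis
        using v c by (simp add: \<tau>_def rm(3) mult flip: w_def)
    qed (simp add: \<tau>_def)
    then show "\<tau> g \<in> \<tau> ` R" using rm(1) by blast
  qed
  then have fin: "finite \<T>" by (rule finite_subset) (simp add: R(1))
  define q where "q v = (\<Sum>t\<in>\<T>. t v)" for v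
  have \<T>U: "t v \<in> U" if "t \<in> \<T>" "v \<in> E" for t v
    using that \<tau>U by (auto simp: \<T>_def)
  \<comment> \<open>Conjugation by \<open>h\<close>, which permutes the set \<open>\<T>\<close> of conjugates of \<open>p\<close>.\<close>
  define c where "c h t = (\<lambda>w. if w \<in> E then \<pi> h (t (\<pi> (inv h) w)) else 0)" for h and t :: "'v \<Rightarrow> 'v"
  have c\<tau>: "c h (\<tau> g) = \<tau> (h \<otimes> g)" if h: "h \<in> P" and g: "g \<in> P" for h g
  proof
    fix w
    show "c h (\<tau> g) w = \<tau> (h \<otimes> g) w"
    proof (cases "w \<in> E")
      case w: True
      have 1: "\<pi> (inv h) w \<in> E" using gE[OF gc(2)[OF h] w] .
      have 2: "p (\<pi> (inv g) (\<pi> (inv h) w)) \<in> V" using p(2)[OF gE[OF gc(2)[OF g] 1]] UV by blast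
      show ?thesis
        using w 1 2 gc(1)[OF h] gc(1)[OF g] EV[OF w]
        by (simp add: c_def \<tau>_def inv_mult_group mult)
    qed (simp add: c_def \<tau>_def)
  qed
  show thesis
  proof
    show "card \<T> \<noteq> 0"
      using fin subgroup.one_closed[OF P] by (auto simp: \<T>_def)
    show "q v \<in> U" if "v \<in> E" for v
      unfolding q_def using \<T>U that by (intro subspace_sum[OF invariantD(1)[OF U(1)]])
    show "q u = scale (of_nat (card \<T>)) u" if u: "u \<in> U" for u
    proof -
      have "t u = u" if t: "t \<in> \<T>" for t
      proof -
        obtain g where g: "g \<in> P" "t = \<tau> g" using t by (auto simp: \<T>_def)
        have "\<pi> (inv g) u \<in> U" using gU[OF gc(2)[OF g(1)] u] .
        then show ?thesis
          using g u U(2) p(3) rep_inv(2)[OF gc(1)[OF g(1)] UV[OF u]] by (auto simp: \<tau>_def)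
      qed
      then have "q u = (\<Sum>t\<in>\<T>. u)" unfolding q_def by (rule sum.cong[OF refl])
      then show ?thesis by (simp only: sum_constant_scale)
    qed
    have t_lin: "t (v + w) = t v + t w" "t (scale k v) = scale k (t v)"
      if t: "t \<in> \<T>" and v: "v \<in> E" and w: "w \<in> E" for t v w k
    proof -
      obtain g where g: "g \<in> P" "t = \<tau> g" using t by (auto simp: \<T>_def)
      note gE' = gE[OF gc(2)[OF g(1)]]
      have i: "inv g \<in> carrier G" using gc(1)[OF g(1)] by simp
      have "p (\<pi> (inv g) (v + w)) = p (\<pi> (inv g) v) + p (\<pi> (inv g) w)"
        using add[OF i EV[OF v] EV[OF w]] equivariantD(1)[OF p(1) gE'[OF v] gE'[OF w]] by simp
      then show "t (v + w) = t v + t w"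
        using v w invariantD(6)[OF E v w] g(2)
          add[OF gc(1)[OF g(1)] UV[OF p(2)[OF gE'[OF v]]] UV[OF p(2)[OF gE'[OF w]]]]
        by (simp add: \<tau>_def)
      have "p (\<pi> (inv g) (scale k v)) = scale k (p (\<pi> (inv g) v))"
        using scale[OF i EV[OF v]] equivariantD(2)[OF p(1) gE'[OF v]] by simp
      then show "t (scale k v) = scale k (t v)"
        using v invariantD(8)[OF E v] g(2) scale[OF gc(1)[OF g(1)] UV[OF p(2)[OF gE'[OF v]]]]
        by (simp add: \<tau>_def)
    qed
    show "equivariant P E q"
      unfolding equivariant_def
    proof (intro conjI ballI allI)
      show "q (v + w) = q v + q w" if "v \<in> E" "w \<in> E" for v w
        unfolding q_def sum.distrib[symmetric] using t_lin(1) that by (intro sum.cong) auto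
      show "q (scale k v) = scale k (q v)" if "v \<in> E" for k v
        unfolding q_def scale_sum_right using t_lin(2) that by (intro sum.cong) auto
      fix h v assume h: "h \<in> P" and v: "v \<in> E"
      have hc: "h \<in> carrier G" "inv h \<in> P" using gc[OF h] by auto
      have cT: "c x t \<in> \<T>" if "x \<in> P" "t \<in> \<T>" for x t
        using that c\<tau> P by (auto simp: \<T>_def subgroup.m_closed)
      have cc: "c (inv x) (c x t) = t" "c x (c (inv x) t) = t" if x: "x \<in> P" and t: "t \<in> \<T>" for x t
      proof -
        obtain g where g: "g \<in> P" "t = \<tau> g" using t by (auto simp: \<T>_def)
        then show "c (inv x) (c x t) = t" "c x (c (inv x) t) = t"
          using x gc[OF x] gc(1)[OF g(1)] P by (simp_all add: c\<tau> subgroup.m_closed m_assoc[symmetric])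
      qed
      have "(\<Sum>t\<in>\<T>. t (\<pi> h v)) = (\<Sum>t\<in>\<T>. \<pi> h (t v))"
      proof (rule sum.reindex_bij_witness[where i = "c h" and j = "c (inv h)"])
        fix t assume t: "t \<in> \<T>"
        show "c h (c (inv h) t) = t" "c (inv h) t \<in> \<T>" using cc(2)[OF h t] cT[OF hc(2) t] .
        show "c (inv h) (c h t) = t" "c h t \<in> \<T>" using cc(1)[OF h t] cT[OF h t] .
        have "\<pi> h v \<in> E" using gE[OF h v] .
        then show "\<pi> h (c (inv h) t v) = t (\<pi> h v)"
          using v hc(1) rep_inv(2)[OF hc(1) UV[OF \<T>U[OF t]]] by (simp add: c_def)
      qed
      also have "\<dots> = \<pi> h (\<Sum>t\<in>\<T>. t v)"
        using rep_sum[OF fin hc(1)] \<T>U v UV by simp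
      finally show "q (\<pi> h v) = \<pi> h (q v)" by (simp add: q_def)
    qed
  qed
qed

end

section \<open>The representation induced by a character\<close>

text \<open>A character of a subgroup, together with the representation that it induces.\<close>

locale induced_character = group G for G :: "('g, 'x) monoid_scheme" (structure) +
  fixes H :: "'g set" and \<chi> :: "'g \<Rightarrow> complex"
  assumes subgroup_H: "subgroup H G"
    and char: "\<chi> \<in> hom (G\<lparr>carrier := H\<rparr>) complex_units"
begin

abbreviation ind :: "('g \<Rightarrow> complex) set" where
  "ind \<equiv> ind_space G H UNIV (char_action \<chi>)"

abbreviation sc :: "complex \<Rightarrow> ('g \<Rightarrow> complex) \<Rightarrow> 'g \<Rightarrow> complex" where
  "sc \<equiv> pointwise_scale (*)"

abbreviation act :: "'g \<Rightarrow> ('g \<Rightarrow> complex) \<Rightarrow> 'g \<Rightarrow> complex" where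
  "act \<equiv> ind_action G"

sublocale rep: group_rep G sc ind act
  by (rule group_rep_ind[OF group_axioms subgroup_H group_rep_char[OF group_axioms subgroup_H char]])

lemma H_carrier: "h \<in> H \<Longrightarrow> h \<in> carrier G"
  using subgroup_H by (rule subgroup.mem_carrier)

lemma H_closed: "\<one> \<in> H" "\<And>h. h \<in> H \<Longrightarrow> inv h \<in> H" "\<And>h k. \<lbrakk>h \<in> H; k \<in> H\<rbrakk> \<Longrightarrow> h \<otimes> k \<in> H"
  using subgroup_H by (simp_all add: subgroup.one_closed subgroup.m_inv_closed subgroup.m_closed)

lemma char_mult: "\<lbrakk>g \<in> H; h \<in> H\<rbrakk> \<Longrightarrow> \<chi> (g \<otimes> h) = \<chi> g * \<chi> h"
  using char by (auto simp: hom_def complex_units_def)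

lemma char_nonzero: "h \<in> H \<Longrightarrow> \<chi> h \<noteq> 0"
  using char by (auto simp: hom_def complex_units_def)

lemma char_one [simp]: "\<chi> \<one> = 1"
  using char_mult[of \<one> \<one>] char_nonzero[of \<one>] H_closed(1) by simp

lemma char_inv: "h \<in> H \<Longrightarrow> \<chi> h * \<chi> (inv h) = 1"
  using char_mult[of h "inv h"] H_closed H_carrier by simp

lemma ind_iff:
  "f \<in> ind \<longleftrightarrow> (\<forall>x. x \<notin> carrier G \<longrightarrow> f x = 0) \<and> (\<forall>h\<in>H. \<forall>g\<in>carrier G. f (h \<otimes> g) = \<chi> h * f g) \<and>
     (\<exists>C. C \<subseteq> rcosets H \<and> finite C \<and> {x \<in> carrier G. f x \<noteq> 0} \<subseteq> \<Union>C)"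
  by (auto simp: ind_space_def char_action_def)

lemma indD:
  assumes "f \<in> ind"
  shows "\<And>x. x \<notin> carrier G \<Longrightarrow> f x = 0" "\<And>h g. \<lbrakk>h \<in> H; g \<in> carrier G\<rbrakk> \<Longrightarrow> f (h \<otimes> g) = \<chi> h * f g"
  using assms by (auto simp: ind_iff)

lemma act_apply: "x \<in> carrier G \<Longrightarrow> act g f x = f (x \<otimes> g)"
  by (simp add: ind_action_def)

text \<open>
  For a subgroup \<open>Q\<close> between \<open>H\<close> and \<open>G\<close>, the subspace \<open>supported Q\<close> is the copy of the
  representation induced from \<open>H\<close> to \<open>Q\<close> inside the one induced to \<open>G\<close>.
\<close>

definition supported :: "'g set \<Rightarrow> ('g \<Rightarrow> complex) set" where
  "supported Q = {f \<in> ind. \<forall>x. x \<notin> Q \<longrightarrow> f x = 0}"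

definition restr :: "'g set \<Rightarrow> ('g \<Rightarrow> complex) \<Rightarrow> 'g \<Rightarrow> complex" where
  "restr Q f = (\<lambda>x. if x \<in> Q then f x else 0)"

text \<open>The canonical generator: the character itself, extended by zero.\<close>

definition delta :: "'g \<Rightarrow> complex" where
  "delta = (\<lambda>x. if x \<in> H then \<chi> x else 0)"

lemma restr_ind:
  assumes f: "f \<in> ind" and Q: "Q \<subseteq> carrier G" "\<And>h x. \<lbrakk>h \<in> H; x \<in> Q\<rbrakk> \<Longrightarrow> h \<otimes> x \<in> Q"
  shows "restr Q f \<in> ind"
proof -
  have iff: "h \<otimes> x \<in> Q \<longleftrightarrow> x \<in> Q" if h: "h \<in> H" and x: "x \<in> carrier G" for h x
  proof
    assume "h \<otimes> x \<in> Q"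
    then have "inv h \<otimes> (h \<otimes> x) \<in> Q" using Q(2) H_closed(2)[OF h] by blast
    then show "x \<in> Q" using h x H_carrier by (simp add: m_assoc[symmetric])
  qed (use Q(2) h in blast)
  obtain C where C: "C \<subseteq> rcosets H" "finite C" "{x \<in> carrier G. f x \<noteq> 0} \<subseteq> \<Union>C"
    using f by (auto simp: ind_iff)
  have "{x \<in> carrier G. restr Q f x \<noteq> 0} \<subseteq> \<Union>C"
    using C(3) by (auto simp: restr_def)
  then have "\<exists>C. C \<subseteq> rcosets H \<and> finite C \<and> {x \<in> carrier G. restr Q f x \<noteq> 0} \<subseteq> \<Union>C"
    using C(1,2) by blast
  then show ?thesis
    using indD[OF f] iff by (simp add: ind_iff) (simp add: restr_def)
qed

lemma supported_invariant:
  assumes Q: "subgroup Q G"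
  shows "rep.invariant Q (supported Q)"
proof -
  have "rep.subspace (supported Q)"
    using rep.space by (auto simp: supported_def rep.subspace_def pointwise_scale_def)
  moreover have "act g f \<in> supported Q" if g: "g \<in> Q" and f: "f \<in> supported Q" for g f
  proof -
    have gc: "g \<in> carrier G" using Q g by (rule subgroup.mem_carrier)
    have "act g f x = 0" if x: "x \<notin> Q" for x
    proof (cases "x \<in> carrier G")
      case xc: True
      have "x \<otimes> g \<notin> Q"
      proof
        assume "x \<otimes> g \<in> Q"
        then have "x \<otimes> g \<otimes> inv g \<in> Q"
          using Q g by (simp add: subgroup.m_closed subgroup.m_inv_closed)
        then show False using x xc gc by (simp add: m_assoc)
      qed
      then show ?thesis using f xc by (simp add: act_apply supported_def)
    qed (simp add: ind_action_def)
    then show ?thesis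
      using f rep.closed[OF gc] by (simp add: supported_def)
  qed
  ultimately show ?thesis
    by (auto simp: rep.invariant_def supported_def)
qed

lemma supported_carrier: "supported (carrier G) = ind"
  by (auto simp: supported_def indD(1))

lemma delta_supported: "delta \<in> supported H"
proof -
  have "h \<otimes> g \<in> H \<longleftrightarrow> g \<in> H" if "h \<in> H" "g \<in> carrier G" for h g
  proof
    assume "h \<otimes> g \<in> H"
    then have "inv h \<otimes> (h \<otimes> g) \<in> H" using that H_closed by blast
    then show "g \<in> H" using that H_carrier by (simp add: m_assoc[symmetric])
  qed (use that H_closed in blast)
  moreover have "H \<in> rcosets H"
    using rcosetsI[of H \<one>] subgroup.subset[OF subgroup_H] coset_mult_one by simp
  then have "\<exists>C. C \<subseteq> rcosets H \<and> finite C \<and> {x \<in> carrier G. delta x \<noteq> 0} \<subseteq> \<Union>C"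
    by (intro exI[of _ "{H}"]) (auto simp: delta_def)
  ultimately show ?thesis
    using H_carrier by (auto simp: supported_def ind_iff char_mult) (auto simp: delta_def char_mult)
qed

lemma delta_ind: "delta \<in> ind"
  using delta_supported by (simp add: supported_def)

lemma delta_one: "delta \<one> = 1"
  by (simp add: delta_def H_closed(1))

lemma act_delta: assumes h: "h \<in> H" shows "act h delta = sc (\<chi> h) delta"
proof
  fix x
  have "x \<otimes> h \<in> H \<longleftrightarrow> x \<in> H" if "x \<in> carrier G"
  proof
    assume "x \<otimes> h \<in> H"
    then have "x \<otimes> h \<otimes> inv h \<in> H" using h H_closed by blast
    then show "x \<in> H" using that h H_carrier by (simp add: m_assoc)
  qed (use h H_closed in blast)
  then show "act h delta x = sc (\<chi> h) delta x"
    using h H_carrier by (auto simp: ind_action_def delta_def pointwise_scale_def char_mult)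
qed

text \<open>
  The translates of \<open>delta\<close> span: a function supported on finitely many cosets \<open>Ha\<close> is the sum of
  the functions \<open>sc (f a) (act (inv a) delta)\<close>.
\<close>

lemma supported_subset:
  assumes Y: "rep.subspace Y" and gen: "\<And>x. x \<in> Q \<Longrightarrow> act (inv x) delta \<in> Y" and Q: "Q \<subseteq> carrier G"
  shows "supported Q \<subseteq> Y"
proof -
  have main: "f \<in> ind \<Longrightarrow> \<forall>x. x \<notin> Q \<longrightarrow> f x = 0 \<Longrightarrow> {x \<in> carrier G. f x \<noteq> 0} \<subseteq> \<Union>C \<Longrightarrow> f \<in> Y"
    if "finite C" "C \<subseteq> rcosets H" for C f
    using that
  proof (induction C arbitrary: f)
    case empty
    then have "f x = 0" for x
      using indD(1)[of f x] by blast
    then have "f = 0" by (simp add: fun_eq_iff)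
    then show ?case using rep.subspace_0[OF Y] by (simp only:)
  next
    case (insert L C)
    obtain a where a: "a \<in> carrier G" "L = H #> a"
      using insert.prems(4) by (auto simp: RCOSETS_def)
    have La: "x \<in> L \<longleftrightarrow> x \<otimes> inv a \<in> H" if "x \<in> carrier G" for x
    proof
      assume "x \<in> L"
      then show "x \<otimes> inv a \<in> H" using a H_carrier by (auto simp: r_coset_def m_assoc)
    next
      assume *: "x \<otimes> inv a \<in> H"
      have "x = (x \<otimes> inv a) \<otimes> a" using that a by (simp add: m_assoc)
      then show "x \<in> L" using * a by (auto simp: r_coset_def)
    qed
    have f: "f \<in> ind" by (rule insert.prems)
    let ?g = "sc (f a) (act (inv a) delta)"
    have gval: "?g x = (if x \<in> L then f x else 0)" if x: "x \<in> carrier G" for x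
    proof (cases "x \<in> L")
      case True
      then have h: "x \<otimes> inv a \<in> H" using La[OF x] by simp
      have "f x = f (x \<otimes> inv a \<otimes> a)" using x a by (simp add: m_assoc)
      also have "\<dots> = \<chi> (x \<otimes> inv a) * f a" by (rule indD(2)[OF f h a(1)])
      finally show ?thesis using True h x by (simp add: pointwise_scale_def act_apply delta_def)
    next
      case False
      then show ?thesis using La[OF x] x by (simp add: pointwise_scale_def act_apply delta_def)
    qed
    have gY: "?g \<in> Y"
    proof (cases "a \<in> Q")
      case True
      then show ?thesis using gen rep.subspace_scale[OF Y] by blast
    next
      case False
      then have "?g = 0" using insert.prems(2) by (simp add: pointwise_scale_def fun_eq_iff)
      then show ?thesis using rep.subspace_0[OF Y] by (simp only:)
    qed
    have gi: "?g \<in> ind"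
      using a delta_ind rep.closed rep.subspace_scale[OF rep.space] by simp
    have "f - ?g \<in> Y"
    proof (rule insert.IH)
      show CH: "C \<subseteq> rcosets H" using insert.prems by simp
      show fg: "f - ?g \<in> ind" using f gi by (rule rep.subspace_diff[OF rep.space])
      have z: "(f - ?g) x = (if x \<in> L then 0 else f x)" if "x \<in> carrier G" for x
        using gval[OF that] by simp
      show "{x \<in> carrier G. (f - ?g) x \<noteq> 0} \<subseteq> \<Union>C"
      proof clarify
        fix x assume x: "x \<in> carrier G" "(f - ?g) x \<noteq> 0"
        then have "x \<notin> L" "f x \<noteq> 0" using z[OF x(1)] by (auto split: if_splits)
        then show "x \<in> \<Union>C" using insert.prems(3) x(1) by blast
      qed
      show "\<forall>x. x \<notin> Q \<longrightarrow> (f - ?g) x = 0"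
        using insert.prems(2) z indD(1)[OF fg] by (metis (full_types))
    qed
    then have "(f - ?g) + ?g \<in> Y" using gY by (rule rep.subspace_add[OF Y])
    then show ?case by simp
  qed
  show ?thesis
  proof
    fix f assume f: "f \<in> supported Q"
    then have "f \<in> ind" and 0: "\<forall>x. x \<notin> Q \<longrightarrow> f x = 0" by (simp_all add: supported_def)
    then obtain C where C: "C \<subseteq> rcosets H" "finite C" "{x \<in> carrier G. f x \<noteq> 0} \<subseteq> \<Union>C"
      unfolding ind_iff by blast
    show "f \<in> Y" by (rule main[OF C(2,1) \<open>f \<in> ind\<close> 0 C(3)])
  qed
qed

text \<open>
  Frobenius reciprocity: the image of \<open>f\<close> is the sum, over the cosets \<open>Hx\<close>, of
  \<open>f x\<close> times the translate of \<open>v\<close> by the inverse of \<open>x\<close>; the eigenvector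
  condition makes each term independent of the representative.
\<close>

lemma frobenius_reciprocity:
  assumes v: "v \<in> ind" and eig: "\<And>h. h \<in> H \<Longrightarrow> act h v = sc (\<chi> h) v"
  obtains T where "T \<in> rep.End_G" "T delta = v"
proof -
  have HG: "H \<subseteq> carrier G" using subgroup_H by (rule subgroup.subset)
  define F where "F f y = sc (f y) (act (inv y) v)" for f y
  define r where "r C = (SOME x. x \<in> C)" for C :: "'g set"
  define supp where "supp f = {C \<in> rcosets H. f (r C) \<noteq> 0}" for f :: "'g \<Rightarrow> complex"
  define T where "T f = (if f \<in> ind then \<Sum>C\<in>supp f. F f (r C) else 0)" for f
  have coset_carrier: "x \<in> carrier G" if "C \<in> rcosets H" "x \<in> C" for C x
    using that r_coset_subset_G[OF HG] by (auto simp: RCOSETS_def)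
  have coset_eq: "C = H #> x" if "C \<in> rcosets H" "x \<in> C" for C x
    using that repr_independence[OF _ _ subgroup_H] by (auto simp: RCOSETS_def)
  have r: "r C \<in> C" if C: "C \<in> rcosets H" for C
  proof -
    obtain a where "a \<in> carrier G" "C = H #> a" using C by (auto simp: RCOSETS_def)
    then have "a \<in> C" using rcos_self[OF _ subgroup_H] by simp
    then show ?thesis unfolding r_def by (rule someI)
  qed
  have F_ind: "F f y \<in> ind" if "y \<in> carrier G" for f y
    unfolding F_def using rep.closed[OF inv_closed[OF that] v] by (rule rep.subspace_scale[OF rep.space])
  have F_H: "F f (h \<otimes> y) = F f y" if f: "f \<in> ind" and h: "h \<in> H" and y: "y \<in> carrier G" for f h y
  proof -
    have hc: "h \<in> carrier G" using H_carrier[OF h] .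
    have "act (inv (h \<otimes> y)) v = act (inv y) (act (inv h) v)"
      using hc y v by (simp add: inv_mult_group rep.mult)
    also have "\<dots> = sc (\<chi> (inv h)) (act (inv y) v)"
      using eig[OF H_closed(2)[OF h]] y v by (simp add: rep.scale)
    finally have "F f (h \<otimes> y) = sc (\<chi> h * f y) (sc (\<chi> (inv h)) (act (inv y) v))"
      unfolding F_def using indD(2)[OF f h y] by simp
    also have "\<dots> = sc ((\<chi> h * \<chi> (inv h)) * f y) (act (inv y) v)"
      by (simp only: rep.scale_scale mult.assoc mult.commute mult.left_commute)
    finally show ?thesis by (simp add: char_inv[OF h] F_def)
  qed
  have F_eq: "F f x = F f y" if f: "f \<in> ind" and C: "C \<in> rcosets H" and xy: "x \<in> C" "y \<in> C" for f C x y
  proof -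
    have "x \<in> H #> y" using coset_eq[OF C xy(2)] xy(1) by simp
    then obtain h where "h \<in> H" "x = h \<otimes> y" by (auto simp: r_coset_def)
    then show ?thesis using F_H[OF f] coset_carrier[OF C xy(2)] by simp
  qed
  have fin: "finite (supp f)" if f: "f \<in> ind" for f
  proof -
    obtain C where C: "C \<subseteq> rcosets H" "finite C" "{x \<in> carrier G. f x \<noteq> 0} \<subseteq> \<Union>C"
      using f unfolding ind_iff by blast
    have "supp f \<subseteq> C"
    proof
      fix D assume "D \<in> supp f"
      then have D: "D \<in> rcosets H" "f (r D) \<noteq> 0" by (simp_all add: supp_def)
      then have "r D \<in> \<Union>C" using C(3) r[OF D(1)] coset_carrier[OF D(1)] by blast
      then obtain L where L: "L \<in> C" "r D \<in> L" by blast
      then have "L = H #> r D" using coset_eq C(1) by blast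
      then show "D \<in> C" using coset_eq[OF D(1) r[OF D(1)]] L(1) by simp
    qed
    then show ?thesis using C(2) by (rule finite_subset)
  qed
  have T_eq: "T f = (\<Sum>C\<in>D. F f (s C))"
    if f: "f \<in> ind" and D: "finite D" "D \<subseteq> rcosets H" "supp f \<subseteq> D" and s: "\<And>C. C \<in> D \<Longrightarrow> s C \<in> C" for f D s
  proof -
    have "F f (r C) = 0" if "C \<in> D - supp f" for C
      using that D(2) by (auto simp: supp_def F_def)
    then have "T f = (\<Sum>C\<in>D. F f (r C))"
      using f sum.mono_neutral_left[OF D(1,3), of "\<lambda>C. F f (r C)"] by (simp add: T_def)
    also have "\<dots> = (\<Sum>C\<in>D. F f (s C))"
      using F_eq[OF f] r s D(2) by (intro sum.cong refl) blast
    finally show ?thesis .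
  qed
  have supp_sub: "supp f \<subseteq> rcosets H" for f by (auto simp: supp_def)
  have T_ind: "T f \<in> ind" if "f \<in> ind" for f
  proof -
    have "F f (r C) \<in> ind" if "C \<in> supp f" for C
      using that r coset_carrier supp_sub by (intro F_ind) blast
    then show ?thesis
      using that rep.subspace_sum[OF rep.space, of "supp f" "\<lambda>C. F f (r C)"] by (simp add: T_def)
  qed
  have "T \<in> rep.End_G"
    unfolding rep.End_G_def
  proof (intro CollectI conjI ballI allI impI)
    show "T f = 0" if "f \<notin> ind" for f using that by (simp only: T_def if_False)
    show "T f \<in> ind" if "f \<in> ind" for f using that by (rule T_ind)
    show "T (f + g) = T f + T g" if fg: "f \<in> ind" "g \<in> ind" for f g
    proof -
      let ?D = "supp f \<union> supp g"
      have D: "finite ?D" "?D \<subseteq> rcosets H" using fin fg supp_sub by auto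
      have rD: "r C \<in> C" if "C \<in> ?D" for C using that r supp_sub by blast
      have "T (f + g) = (\<Sum>C\<in>?D. F (f + g) (r C))"
        by (rule T_eq[OF rep.subspace_add[OF rep.space fg] D _ rD]) (auto simp: supp_def)
      also have "\<dots> = (\<Sum>C\<in>?D. F f (r C) + F g (r C))"
        by (simp add: F_def rep.scale_left_distrib)
      also have "\<dots> = T f + T g"
        unfolding sum.distrib using T_eq[OF fg(1) D _ rD] T_eq[OF fg(2) D _ rD] by simp
      finally show ?thesis .
    qed
    show "T (sc c f) = sc c (T f)" if f: "f \<in> ind" for c f
    proof -
      note D = fin[OF f] supp_sub
      have rD: "r C \<in> C" if "C \<in> supp f" for C using that r supp_sub by blast
      have "T (sc c f) = (\<Sum>C\<in>supp f. F (sc c f) (r C))"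
        by (rule T_eq[OF rep.subspace_scale[OF rep.space f] D _ rD]) (auto simp: supp_def pointwise_scale_def)
      also have "\<dots> = (\<Sum>C\<in>supp f. sc c (F f (r C)))"
        by (intro sum.cong refl) (simp add: F_def pointwise_scale_def mult.assoc)
      also have "\<dots> = sc c (T f)"
        using f by (simp add: T_def flip: rep.scale_sum_right)
      finally show ?thesis .
    qed
    show "T (act a f) = act a (T f)" if a: "a \<in> carrier G" and f: "f \<in> ind" for a f
    proof -
      let ?m = "\<lambda>C. C #> inv a"
      let ?D = "?m ` supp f"
      have sub: "C \<subseteq> carrier G" if "C \<in> rcosets H" for C
        using coset_carrier[OF that] by blast
      have m_a: "?m C #> a = C" if "C \<subseteq> carrier G" for C
        using that a by (simp add: coset_mult_assoc coset_mult_one)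
      have a_m: "?m (C #> a) = C" if "C \<subseteq> carrier G" for C
        using that a by (simp add: coset_mult_assoc coset_mult_one)
      have mem: "x \<otimes> b \<in> C #> b" if "x \<in> C" for x b C
        using that by (auto simp: r_coset_def)
      have coset_m: "C #> b \<in> rcosets H" if "C \<in> rcosets H" "b \<in> carrier G" for C b
      proof -
        obtain x where x: "x \<in> carrier G" "C = H #> x" using \<open>C \<in> rcosets H\<close> by (auto simp: RCOSETS_def)
        then show ?thesis
          using rcosetsI[OF HG, of "x \<otimes> b"] \<open>b \<in> carrier G\<close> HG by (simp add: coset_mult_assoc)
      qed
      have D: "finite ?D" "?D \<subseteq> rcosets H"
        using fin[OF f] coset_m[OF _ inv_closed[OF a]] supp_sub[of f] by auto
      have afi: "act a f \<in> ind" using a f by (rule rep.closed)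
      have nz: "f x \<noteq> 0 \<longleftrightarrow> f y \<noteq> 0" if C: "C \<in> rcosets H" and xy: "x \<in> C" "y \<in> C" for C x y
      proof -
        have "x \<in> H #> y" using coset_eq[OF C xy(2)] xy(1) by simp
        then obtain h where "h \<in> H" "x = h \<otimes> y" by (auto simp: r_coset_def)
        then show ?thesis
          using indD(2)[OF f] coset_carrier[OF C xy(2)] char_nonzero by simp
      qed
      have supp_D: "supp (act a f) \<subseteq> ?D"
      proof
        fix C assume "C \<in> supp (act a f)"
        then have C: "C \<in> rcosets H" "act a f (r C) \<noteq> 0" by (simp_all add: supp_def)
        then have "f (r C \<otimes> a) \<noteq> 0" using r[OF C(1)] coset_carrier[OF C(1)] by (simp add: act_apply)
        moreover have "C #> a \<in> rcosets H" using coset_m[OF C(1) a] .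
        ultimately have "C #> a \<in> supp f"
          using nz[OF _ mem[OF r[OF C(1)]] r] by (simp add: supp_def)
        then show "C \<in> ?D" using a_m[OF sub[OF C(1)]] by (metis imageI)
      qed
      have s_D: "r (C #> a) \<otimes> inv a \<in> C" if "C \<in> ?D" for C
      proof -
        have C: "C \<in> rcosets H" using that D(2) by blast
        show ?thesis
          using mem[OF r[OF coset_m[OF C a]], of "inv a"] a_m[OF sub[OF C]] by simp
      qed
      have "T (act a f) = (\<Sum>C\<in>?D. F (act a f) (r (C #> a) \<otimes> inv a))"
        by (rule T_eq[OF afi D supp_D s_D])
      also have "\<dots> = (\<Sum>C\<in>supp f. F (act a f) (r (?m C #> a) \<otimes> inv a))"
      proof (rule sum.reindex_cong[of ?m])
        show "inj_on ?m (supp f)"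
          using m_a sub supp_sub[of f] by (intro inj_on_inverseI[of _ "\<lambda>C. C #> a"]) blast
      qed simp_all
      also have "\<dots> = (\<Sum>C\<in>supp f. act a (F f (r C)))"
      proof (rule sum.cong[OF refl])
        fix C assume "C \<in> supp f"
        then have C: "C \<in> rcosets H" using supp_sub by blast
        have rc: "r C \<in> carrier G" using coset_carrier[OF C r[OF C]] .
        have "F (act a f) (r C \<otimes> inv a) = sc (f (r C)) (act (a \<otimes> inv (r C)) v)"
          using a rc by (simp add: F_def act_apply m_assoc inv_mult_group)
        also have "\<dots> = act a (F f (r C))"
          using a rc v by (simp add: F_def rep.scale rep.closed rep.mult)
        finally show "F (act a f) (r (?m C #> a) \<otimes> inv a) = act a (F f (r C))"
          using m_a[OF sub[OF C]] by simp
      qed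
      also have "\<dots> = act a (T f)"
      proof -
        have "F f (r C) \<in> ind" if "C \<in> supp f" for C
          using that r coset_carrier supp_sub by (intro F_ind) blast
        then show ?thesis
          using rep.rep_sum[OF fin[OF f] a, of "\<lambda>C. F f (r C)"] f by (simp add: T_def)
      qed
      finally show ?thesis .
    qed
  qed
  moreover have "T delta = v"
  proof -
    have HH: "H \<in> rcosets H"
      using rcosetsI[OF HG one_closed] HG by (simp add: coset_mult_one)
    have "supp delta \<subseteq> {H}"
    proof
      fix C assume "C \<in> supp delta"
      then have C: "C \<in> rcosets H" "r C \<in> H" by (auto simp: supp_def delta_def split: if_splits)
      then show "C \<in> {H}" using coset_eq[OF C(1) r[OF C(1)]] coset_eq[OF HH C(2)] by simp
    qed
    then have "T delta = (\<Sum>C\<in>{H}. F delta \<one>)"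
      using HH H_closed(1) by (intro T_eq[OF delta_ind]) auto
    then show ?thesis
      using v rep.one by (simp add: F_def delta_one)
  qed
  ultimately show thesis by (rule that)
qed

text \<open>
  The only consequence of Schur irreducibility used below.  The vector \<open>delta\<close> is an eigenvector
  of \<open>H\<close> with character \<open>\<chi>\<close>; Schur irreducibility makes it the only one up to scalars.
\<close>

lemma schur_eigenvector:
  assumes schur: "vector_space.dim (pointwise_scale sc) rep.End_G = 1"
    and v: "v \<in> ind" and eig: "\<And>h. h \<in> H \<Longrightarrow> act h v = sc (\<chi> h) v"
  shows "\<exists>c. v = sc c delta"
proof -
  interpret E: vector_space "pointwise_scale sc :: complex \<Rightarrow> (('g \<Rightarrow> complex) \<Rightarrow> 'g \<Rightarrow> complex) \<Rightarrow> _"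
    by (rule vector_space_pointwise_scale[OF rep.vector_space_axioms])
  obtain B where B: "rep.End_G \<subseteq> E.span B" "card B = E.dim rep.End_G"
    by (rule E.basis_exists)
  have "card B = 1" using B(2) schur by (rule trans)
  then obtain S where S0: "B = {S}" by (rule card_1_singletonE)
  have S: "\<exists>c. T = pointwise_scale sc c S" if "T \<in> rep.End_G" for T
    using subsetD[OF B(1) that] unfolding S0 E.span_singleton by (rule rangeE) (rule exI)
  obtain T where T: "T \<in> rep.End_G" "T delta = v"
    by (rule frobenius_reciprocity[OF v eig])
  obtain I where I: "I \<in> rep.End_G" "I delta = delta"
    by (rule frobenius_reciprocity[OF delta_ind act_delta])
  obtain c where c: "T = pointwise_scale sc c S" using S[OF T(1)] by (rule exE)
  obtain d where d: "I = pointwise_scale sc d S" using S[OF I(1)] by (rule exE)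
  have v_eq: "v = sc c (S delta)"
    using T(2) c by (simp add: pointwise_scale_def)
  have d_eq: "delta = sc d (S delta)"
    using I(2) d by (simp add: pointwise_scale_def)
  have "d \<noteq> 0"
    using d_eq delta_one by (auto simp: pointwise_scale_def fun_eq_iff)
  then have "sc (c / d) (sc d (S delta)) = v"
    unfolding v_eq by (simp add: pointwise_scale_def)
  then have "v = sc (c / d) delta" unfolding d_eq[symmetric] by (rule sym)
  then show ?thesis by (rule exI)
qed

end

section \<open>Adjoining a normalized cyclic group\<close>

lemma (in group) conj_int_pow:
  assumes "g \<in> carrier G" "x \<in> carrier G"
  shows "g \<otimes> x [^] (k::int) \<otimes> inv g = (g \<otimes> x \<otimes> inv g) [^] k"
proof -
  have "(\<lambda>x. g \<otimes> x \<otimes> inv g) \<in> hom G G"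
  proof (rule homI)
    fix x y assume "x \<in> carrier G" "y \<in> carrier G"
    then have "g \<otimes> x \<otimes> inv g \<otimes> (g \<otimes> y \<otimes> inv g) = g \<otimes> x \<otimes> (inv g \<otimes> g) \<otimes> y \<otimes> inv g"
      using assms(1) by (simp only: m_assoc m_closed inv_closed)
    then show "g \<otimes> (x \<otimes> y) \<otimes> inv g = g \<otimes> x \<otimes> inv g \<otimes> (g \<otimes> y \<otimes> inv g)"
      using assms(1) \<open>x \<in> carrier G\<close> \<open>y \<in> carrier G\<close> by (simp add: m_assoc)
  qed (use assms(1) in simp)
  from hom_int_pow[OF this assms(2) group_axioms group_axioms, of k] show ?thesis .
qed

lemma (in group) conj_eq_iff:
  assumes "g \<in> carrier G" "x \<in> carrier G" "y \<in> carrier G"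
  shows "g \<otimes> x \<otimes> inv g = y \<longleftrightarrow> g \<otimes> x = y \<otimes> g"
  using assms by (metis inv_closed m_assoc m_closed l_inv r_inv r_one)

lemma (in group) commute_int_pow:
  assumes "g \<in> carrier G" "x \<in> carrier G" "g \<otimes> x = x \<otimes> g"
  shows "g \<otimes> x [^] (k::int) = x [^] k \<otimes> g"
proof -
  have "g \<otimes> x \<otimes> inv g = x" using conj_eq_iff[OF assms(1,2,2)] assms(3) by simp
  then have "g \<otimes> x [^] k \<otimes> inv g = x [^] k" using conj_int_pow[OF assms(1,2), of k] by simp
  then show ?thesis using conj_eq_iff[OF assms(1)] assms(2) by simp
qed

lemma (in group) conj_pow_move:
  assumes "g \<in> carrier G" "x \<in> carrier G" "g \<otimes> x \<otimes> inv g = x [^] (e::int)"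
  shows "g \<otimes> x [^] (k::int) = x [^] (e * k) \<otimes> g"
proof -
  have "g \<otimes> x [^] k \<otimes> inv g = x [^] (e * k)"
    using conj_int_pow[OF assms(1,2), of k] assms(2,3) by (simp add: int_pow_pow)
  then show ?thesis using conj_eq_iff[OF assms(1)] assms(2) by simp
qed

lemma (in group) finite_transversal:
  assumes fin: "finite (f ` P)" and f: "\<And>x y. \<lbrakk>x \<in> P; y \<in> P; f x = f y\<rbrakk> \<Longrightarrow> inv x \<otimes> y \<in> M"
    and P: "P \<subseteq> carrier G"
  obtains R where "finite R" "R \<subseteq> P" "\<And>g. g \<in> P \<Longrightarrow> \<exists>r\<in>R. \<exists>m\<in>M. g = r \<otimes> m"
proof
  let ?s = "\<lambda>y. SOME x. x \<in> P \<and> f x = y"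
  have s: "?s (f g) \<in> P \<and> f (?s (f g)) = f g" if "g \<in> P" for g
    using that by (intro someI_ex[of "\<lambda>x. x \<in> P \<and> f x = f g"]) blast
  show "finite (?s ` f ` P)" using fin by simp
  show "?s ` f ` P \<subseteq> P" using s by blast
  fix g assume g: "g \<in> P"
  have "g = ?s (f g) \<otimes> (inv (?s (f g)) \<otimes> g)"
    using s[OF g] g P by (simp add: m_assoc[symmetric] subset_iff)
  moreover have "inv (?s (f g)) \<otimes> g \<in> M" using s[OF g] g f by blast
  ultimately show "\<exists>r\<in>?s ` f ` P. \<exists>m\<in>M. g = r \<otimes> m" using g by blast
qed

lemma (in group) finite_int_pow_range:
  assumes x: "x \<in> carrier G" and n: "n \<noteq> 0" "x [^] (n::int) = \<one>"
  shows "finite (range (\<lambda>k::int. x [^] k))"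
proof -
  have "x [^] k \<in> (\<lambda>k. x [^] k) ` {0..<\<bar>n\<bar>}" for k :: int
  proof -
    have "x [^] \<bar>n\<bar> = \<one>" using x n by (cases "n \<ge> 0") (auto simp: int_pow_neg)
    then have "x [^] (\<bar>n\<bar> * (k div \<bar>n\<bar>)) = \<one>" by (simp add: int_pow_pow[OF x, symmetric])
    then have "x [^] k = x [^] (k mod \<bar>n\<bar>)"
      using int_pow_mult[OF x, of "\<bar>n\<bar> * (k div \<bar>n\<bar>)" "k mod \<bar>n\<bar>"] x by simp
    then show ?thesis using n(1) by simp
  qed
  then have "range (\<lambda>k::int. x [^] k) \<subseteq> (\<lambda>k. x [^] k) ` {0..<\<bar>n\<bar>}" by blast
  then show ?thesis by (rule finite_subset) simp
qed

text \<open>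
  One step in the series: \<open>\<nu>\<close> stands for the quotient map by the smaller normal subgroup, and
  \<open>b\<close> maps to a generator of the cyclic factor.  Only the fact that \<open>H\<close> normalizes the cyclic
  group generated by \<open>\<nu> b\<close> is needed.
\<close>

locale cyclic_step = induced_character G H \<chi> + q: group_hom G Q \<nu>
  for G :: "('g, 'x) monoid_scheme" (structure) and H \<chi> and Q :: "('q, 'y) monoid_scheme" and \<nu> +
  fixes b :: 'g
  assumes b: "b \<in> carrier G"
    and normalizes: "\<And>h. h \<in> H \<Longrightarrow> \<exists>e::int. \<nu> h \<otimes>\<^bsub>Q\<^esub> \<nu> b \<otimes>\<^bsub>Q\<^esub> inv\<^bsub>Q\<^esub> \<nu> h = \<nu> b [^]\<^bsub>Q\<^esub> e"
begin

abbreviation beta :: "int \<Rightarrow> 'q" where "beta k \<equiv> \<nu> b [^]\<^bsub>Q\<^esub> k"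

text \<open>
  If \<open>N\<close> is the kernel of \<open>\<nu>\<close>, then \<open>P\<close> is \<open>NH\<close>, and \<open>L\<close> is the group generated by \<open>P\<close> and
  \<open>b\<close>.  The subgroup \<open>M\<close> of the elements of \<open>P\<close> that commute with \<open>b\<close> modulo \<open>N\<close> is normal in
  \<open>L\<close>; its index in \<open>P\<close> is finite because a cyclic group has finitely many automorphisms.
\<close>

definition P :: "'g set" where
  "P = {x \<in> carrier G. \<nu> x \<in> \<nu> ` H}"

definition L :: "'g set" where
  "L = {x \<in> carrier G. \<exists>k::int. \<exists>h\<in>H. \<nu> x = beta k \<otimes>\<^bsub>Q\<^esub> \<nu> h}"

definition M :: "'g set" where
  "M = {x \<in> P. \<nu> x \<otimes>\<^bsub>Q\<^esub> \<nu> b = \<nu> b \<otimes>\<^bsub>Q\<^esub> \<nu> x}"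

lemma nu_closed: "x \<in> carrier G \<Longrightarrow> \<nu> x \<in> carrier Q" by simp

lemma nu_H: "h \<in> H \<Longrightarrow> \<nu> h \<in> carrier Q" using H_carrier by simp

lemma beta_closed: "beta k \<in> carrier Q" using b by simp

lemma nu_b_pow: "\<nu> (b [^] (k::int)) = beta k"
  using b by (rule q.hom_int_pow)

lemma beta_add: "beta (j + k) = beta j \<otimes>\<^bsub>Q\<^esub> beta k"
  using b by (simp add: q.H.int_pow_mult)

lemma image_H_closed:
  "\<lbrakk>x \<in> \<nu> ` H; y \<in> \<nu> ` H\<rbrakk> \<Longrightarrow> x \<otimes>\<^bsub>Q\<^esub> y \<in> \<nu> ` H" "x \<in> \<nu> ` H \<Longrightarrow> inv\<^bsub>Q\<^esub> x \<in> \<nu> ` H"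
  "\<one>\<^bsub>Q\<^esub> \<in> \<nu> ` H"
proof -
  have "subgroup (\<nu> ` H) Q" by (rule q.subgroup_img_is_subgroup[OF subgroup_H])
  then show "\<lbrakk>x \<in> \<nu> ` H; y \<in> \<nu> ` H\<rbrakk> \<Longrightarrow> x \<otimes>\<^bsub>Q\<^esub> y \<in> \<nu> ` H" "x \<in> \<nu> ` H \<Longrightarrow> inv\<^bsub>Q\<^esub> x \<in> \<nu> ` H"
    "\<one>\<^bsub>Q\<^esub> \<in> \<nu> ` H"
    by (simp_all add: subgroup.m_closed subgroup.m_inv_closed subgroup.one_closed)
qed

lemma nu_H_beta:
  assumes "h \<in> H"
  shows "\<exists>e::int. \<forall>k. \<nu> h \<otimes>\<^bsub>Q\<^esub> beta k = beta (e * k) \<otimes>\<^bsub>Q\<^esub> \<nu> h"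
proof -
  obtain e :: int where "\<nu> h \<otimes>\<^bsub>Q\<^esub> \<nu> b \<otimes>\<^bsub>Q\<^esub> inv\<^bsub>Q\<^esub> \<nu> h = beta e"
    using normalizes[OF assms] by blast
  then show ?thesis
    using q.H.conj_pow_move[OF nu_H[OF assms] nu_closed[OF b]] by blast
qed

lemma subgroup_P: "subgroup P G"
proof (rule subgroupI)
  show "P \<noteq> {}" using H_closed(1) by (auto simp: P_def)
qed (auto simp: P_def image_H_closed)

lemma subgroup_M: "subgroup M G"
proof (rule subgroupI)
  show "M \<subseteq> carrier G" by (auto simp: M_def P_def)
  show "M \<noteq> {}" using b H_closed(1) subgroup.one_closed[OF subgroup_P] by (auto simp: M_def)
  show "inv x \<in> M" if x: "x \<in> M" for x
  proof -
    have "x \<in> carrier G" using x by (simp add: M_def P_def)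
    then have "inv\<^bsub>Q\<^esub> \<nu> x \<otimes>\<^bsub>Q\<^esub> \<nu> b = \<nu> b \<otimes>\<^bsub>Q\<^esub> inv\<^bsub>Q\<^esub> \<nu> x"
      using x b q.H.commute_int_pow[of "\<nu> b" "\<nu> x" "-1"] by (simp add: M_def q.H.int_pow_neg)
    then show ?thesis
      using x subgroup.m_inv_closed[OF subgroup_P] by (simp add: M_def P_def)
  qed
  show "x \<otimes> y \<in> M" if x: "x \<in> M" and y: "y \<in> M" for x y
  proof -
    have xy: "x \<in> carrier G" "y \<in> carrier G" "x \<in> P" "y \<in> P" using x y by (simp_all add: M_def P_def)
    have "\<nu> x \<otimes>\<^bsub>Q\<^esub> \<nu> y \<otimes>\<^bsub>Q\<^esub> \<nu> b = \<nu> x \<otimes>\<^bsub>Q\<^esub> (\<nu> b \<otimes>\<^bsub>Q\<^esub> \<nu> y)"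
      using xy b y by (simp add: M_def q.H.m_assoc)
    also have "\<dots> = \<nu> b \<otimes>\<^bsub>Q\<^esub> (\<nu> x \<otimes>\<^bsub>Q\<^esub> \<nu> y)"
      using xy b x by (simp add: M_def q.H.m_assoc[symmetric])
    finally show ?thesis
      using xy subgroup.m_closed[OF subgroup_P] by (simp add: M_def)
  qed
qed

lemma subgroup_L: "subgroup L G"
proof (rule subgroupI)
  show "L \<subseteq> carrier G" by (auto simp: L_def)
  have "\<one> \<in> L"
    using H_closed(1) by (auto simp: L_def intro!: exI[of _ "0::int"] bexI[of _ \<one>])
  then show "L \<noteq> {}" by blast
  show "inv x \<in> L" if xL: "x \<in> L" for x
  proof -
    obtain k h where x: "x \<in> carrier G" and h: "h \<in> H" and nx: "\<nu> x = beta k \<otimes>\<^bsub>Q\<^esub> \<nu> h"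
      using xL by (auto simp: L_def)
    obtain e :: int where e: "\<And>k. \<nu> (inv h) \<otimes>\<^bsub>Q\<^esub> beta k = beta (e * k) \<otimes>\<^bsub>Q\<^esub> \<nu> (inv h)"
      using nu_H_beta[OF H_closed(2)[OF h]] by blast
    have "\<nu> (inv x) = \<nu> (inv h) \<otimes>\<^bsub>Q\<^esub> beta (- k)"
      using x nx nu_H[OF h] H_carrier[OF h] b by (simp add: q.H.inv_mult_group q.H.int_pow_neg)
    then have "\<nu> (inv x) = beta (e * (- k)) \<otimes>\<^bsub>Q\<^esub> \<nu> (inv h)" by (simp only: e)
    then show ?thesis using x H_closed(2)[OF h] unfolding L_def by blast
  qed
  show "x \<otimes> y \<in> L" if xL: "x \<in> L" and yL: "y \<in> L" for x y
  proof -
    obtain k h where x: "x \<in> carrier G" and h: "h \<in> H" and nx: "\<nu> x = beta k \<otimes>\<^bsub>Q\<^esub> \<nu> h"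
      using xL by (auto simp: L_def)
    obtain j g where y: "y \<in> carrier G" and g: "g \<in> H" and ny: "\<nu> y = beta j \<otimes>\<^bsub>Q\<^esub> \<nu> g"
      using yL by (auto simp: L_def)
    obtain e :: int where e: "\<And>k. \<nu> h \<otimes>\<^bsub>Q\<^esub> beta k = beta (e * k) \<otimes>\<^bsub>Q\<^esub> \<nu> h"
      using nu_H_beta[OF h] by blast
    note c = beta_closed nu_H[OF h] nu_H[OF g]
    have "\<nu> (x \<otimes> y) = beta k \<otimes>\<^bsub>Q\<^esub> (\<nu> h \<otimes>\<^bsub>Q\<^esub> beta j) \<otimes>\<^bsub>Q\<^esub> \<nu> g"
      using x y c by (simp add: nx ny q.H.m_assoc)
    also have "\<dots> = beta k \<otimes>\<^bsub>Q\<^esub> (beta (e * j) \<otimes>\<^bsub>Q\<^esub> \<nu> h) \<otimes>\<^bsub>Q\<^esub> \<nu> g"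
      by (simp only: e)
    also have "\<dots> = beta (k + e * j) \<otimes>\<^bsub>Q\<^esub> \<nu> (h \<otimes> g)"
      using c H_carrier[OF h] H_carrier[OF g] by (simp add: q.H.m_assoc beta_add)
    finally show ?thesis using x y H_closed(3)[OF h g] unfolding L_def by blast
  qed
qed

lemma M_sub_P: "M \<subseteq> P" by (auto simp: M_def)

lemma H_sub_P: "H \<subseteq> P" using H_carrier by (auto simp: P_def)

lemma P_sub_L: "P \<subseteq> L"
proof
  fix x assume "x \<in> P"
  then obtain h where "x \<in> carrier G" "h \<in> H" "\<nu> x = \<nu> h" by (auto simp: P_def)
  then show "x \<in> L" using nu_H by (auto simp: L_def intro!: exI[of _ "0::int"] bexI[of _ h])
qed

lemma kernel_sub_M: "\<lbrakk>x \<in> carrier G; \<nu> x = \<one>\<^bsub>Q\<^esub>\<rbrakk> \<Longrightarrow> x \<in> M"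
  using b image_H_closed(3) by (simp add: M_def P_def)

lemma b_pow_L: "b [^] (k::int) \<in> L"
  using b H_closed(1) nu_b_pow unfolding L_def by (auto intro!: exI[of _ k] bexI[of _ \<one>])

lemma P_decomp:
  assumes "x \<in> P" obtains h m where "h \<in> H" "m \<in> M" "x = h \<otimes> m"
proof -
  obtain h where h: "x \<in> carrier G" "h \<in> H" "\<nu> x = \<nu> h" using assms by (auto simp: P_def)
  have "inv h \<otimes> x \<in> M" using h H_carrier[of h] by (intro kernel_sub_M) simp_all
  moreover have "x = h \<otimes> (inv h \<otimes> x)" using h H_carrier[of h] by (simp add: m_assoc[symmetric])
  ultimately show thesis using that h(2) by blast
qed

lemma L_decomp:
  assumes "x \<in> L" obtains h m k where "h \<in> H" "m \<in> M" "x = m \<otimes> b [^] (k::int) \<otimes> h"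
proof -
  obtain k h where x: "x \<in> carrier G" and h: "h \<in> H" and nx: "\<nu> x = beta k \<otimes>\<^bsub>Q\<^esub> \<nu> h"
    using assms by (auto simp: L_def)
  note c = x H_carrier[OF h] b beta_closed[of k] nu_H[OF h]
  let ?y = "b [^] k \<otimes> h"
  have "\<nu> ?y = \<nu> x" using c by (simp add: nx nu_b_pow)
  then have "x \<otimes> inv ?y \<in> M" using c by (intro kernel_sub_M) simp_all
  moreover have "x = (x \<otimes> inv ?y) \<otimes> b [^] k \<otimes> h"
    using c by (simp add: m_assoc)
  ultimately show thesis using that h by blast
qed

lemma M_normal:
  assumes g: "g \<in> L" and m: "m \<in> M"
  shows "inv g \<otimes> m \<otimes> g \<in> M"
proof -
  obtain k h where gc: "g \<in> carrier G" and h: "h \<in> H" and ng: "\<nu> g = beta k \<otimes>\<^bsub>Q\<^esub> \<nu> h"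
    using g by (auto simp: L_def)
  have mc: "m \<in> carrier G" "\<nu> m \<in> \<nu> ` H" and mb: "\<nu> m \<otimes>\<^bsub>Q\<^esub> \<nu> b = \<nu> b \<otimes>\<^bsub>Q\<^esub> \<nu> m"
    using m by (auto simp: M_def P_def)
  note c = nu_closed[OF mc(1)] nu_H[OF h] nu_closed[OF b] beta_closed
  have mk: "\<nu> m \<otimes>\<^bsub>Q\<^esub> beta k = beta k \<otimes>\<^bsub>Q\<^esub> \<nu> m" for k
    using q.H.commute_int_pow[OF c(1,3) mb] .
  let ?y = "inv\<^bsub>Q\<^esub> \<nu> h \<otimes>\<^bsub>Q\<^esub> \<nu> m \<otimes>\<^bsub>Q\<^esub> \<nu> h"
  have "\<nu> (inv g \<otimes> m \<otimes> g) = inv\<^bsub>Q\<^esub> \<nu> h \<otimes>\<^bsub>Q\<^esub> (inv\<^bsub>Q\<^esub> beta k \<otimes>\<^bsub>Q\<^esub> (\<nu> m \<otimes>\<^bsub>Q\<^esub> beta k)) \<otimes>\<^bsub>Q\<^esub> \<nu> h"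
    using gc mc c by (simp add: ng q.H.inv_mult_group q.H.m_assoc)
  also have "inv\<^bsub>Q\<^esub> beta k \<otimes>\<^bsub>Q\<^esub> (\<nu> m \<otimes>\<^bsub>Q\<^esub> beta k) = \<nu> m"
    unfolding mk using c by (simp add: q.H.m_assoc[symmetric])
  finally have y: "\<nu> (inv g \<otimes> m \<otimes> g) = ?y" .
  moreover have "?y \<in> \<nu> ` H"
    by (intro image_H_closed imageI h mc(2))
  moreover have "?y \<otimes>\<^bsub>Q\<^esub> \<nu> b = \<nu> b \<otimes>\<^bsub>Q\<^esub> ?y"
  proof -
    obtain e :: int where e: "\<And>k. \<nu> h \<otimes>\<^bsub>Q\<^esub> beta k = beta (e * k) \<otimes>\<^bsub>Q\<^esub> \<nu> h"
      using nu_H_beta[OF h] by blast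
    have hb: "\<nu> h \<otimes>\<^bsub>Q\<^esub> \<nu> b = beta e \<otimes>\<^bsub>Q\<^esub> \<nu> h"
      using e[of 1] c(3) by simp
    have "?y \<otimes>\<^bsub>Q\<^esub> \<nu> b = inv\<^bsub>Q\<^esub> \<nu> h \<otimes>\<^bsub>Q\<^esub> (\<nu> m \<otimes>\<^bsub>Q\<^esub> beta e) \<otimes>\<^bsub>Q\<^esub> \<nu> h"
      using c by (simp add: q.H.m_assoc hb)
    also have "\<dots> = inv\<^bsub>Q\<^esub> \<nu> h \<otimes>\<^bsub>Q\<^esub> beta e \<otimes>\<^bsub>Q\<^esub> (\<nu> m \<otimes>\<^bsub>Q\<^esub> \<nu> h)"
      unfolding mk using c by (simp add: q.H.m_assoc)
    also have "inv\<^bsub>Q\<^esub> \<nu> h \<otimes>\<^bsub>Q\<^esub> beta e = \<nu> b \<otimes>\<^bsub>Q\<^esub> inv\<^bsub>Q\<^esub> \<nu> h"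
    proof -
      have "inv\<^bsub>Q\<^esub> \<nu> h \<otimes>\<^bsub>Q\<^esub> (\<nu> h \<otimes>\<^bsub>Q\<^esub> \<nu> b) \<otimes>\<^bsub>Q\<^esub> inv\<^bsub>Q\<^esub> \<nu> h
          = inv\<^bsub>Q\<^esub> \<nu> h \<otimes>\<^bsub>Q\<^esub> (beta e \<otimes>\<^bsub>Q\<^esub> \<nu> h) \<otimes>\<^bsub>Q\<^esub> inv\<^bsub>Q\<^esub> \<nu> h"
        by (simp only: hb)
      then have "(inv\<^bsub>Q\<^esub> \<nu> h \<otimes>\<^bsub>Q\<^esub> \<nu> h) \<otimes>\<^bsub>Q\<^esub> \<nu> b \<otimes>\<^bsub>Q\<^esub> inv\<^bsub>Q\<^esub> \<nu> h
          = inv\<^bsub>Q\<^esub> \<nu> h \<otimes>\<^bsub>Q\<^esub> beta e \<otimes>\<^bsub>Q\<^esub> (\<nu> h \<otimes>\<^bsub>Q\<^esub> inv\<^bsub>Q\<^esub> \<nu> h)"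
        using c by (simp only: q.H.m_assoc q.H.m_closed q.H.inv_closed)
      then show ?thesis using c by simp
    qed
    finally show ?thesis using c by (simp add: q.H.m_assoc)
  qed
  ultimately show ?thesis
    using gc mc by (simp add: M_def P_def)
qed

lemma M_normal': "\<lbrakk>g \<in> L; m \<in> M\<rbrakk> \<Longrightarrow> g \<otimes> m \<otimes> inv g \<in> M"
  using M_normal[of "inv g" m] subgroup.m_inv_closed[OF subgroup_L] subgroup.mem_carrier[OF subgroup_L]
  by simp

text \<open>An automorphism of an infinite cyclic group is trivial or the inversion.\<close>

lemma conj_infinite_order:
  assumes h: "h \<in> H" and inf: "\<And>n::int. n \<noteq> 0 \<Longrightarrow> beta n \<noteq> \<one>\<^bsub>Q\<^esub>"
  shows "(\<forall>k. \<nu> h \<otimes>\<^bsub>Q\<^esub> beta k = beta k \<otimes>\<^bsub>Q\<^esub> \<nu> h) \<or> (\<forall>k. \<nu> h \<otimes>\<^bsub>Q\<^esub> beta k = beta (- k) \<otimes>\<^bsub>Q\<^esub> \<nu> h)"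
proof -
  obtain e :: int where e: "\<And>k. \<nu> h \<otimes>\<^bsub>Q\<^esub> beta k = beta (e * k) \<otimes>\<^bsub>Q\<^esub> \<nu> h"
    using nu_H_beta[OF h] by blast
  obtain f :: int where f: "\<And>k. \<nu> (inv h) \<otimes>\<^bsub>Q\<^esub> beta k = beta (f * k) \<otimes>\<^bsub>Q\<^esub> \<nu> (inv h)"
    using nu_H_beta[OF H_closed(2)[OF h]] by blast
  note c = beta_closed nu_H[OF h] H_carrier[OF h] nu_H[OF H_closed(2)[OF h]]
  have one: "\<nu> h \<otimes>\<^bsub>Q\<^esub> \<nu> (inv h) = \<one>\<^bsub>Q\<^esub>" using c by simp
  have "beta 1 = (\<nu> h \<otimes>\<^bsub>Q\<^esub> \<nu> (inv h)) \<otimes>\<^bsub>Q\<^esub> beta 1" unfolding one using c by simp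
  also have "\<dots> = \<nu> h \<otimes>\<^bsub>Q\<^esub> (\<nu> (inv h) \<otimes>\<^bsub>Q\<^esub> beta 1)" using c by (simp only: q.H.m_assoc)
  also have "\<dots> = \<nu> h \<otimes>\<^bsub>Q\<^esub> (beta (f * 1) \<otimes>\<^bsub>Q\<^esub> \<nu> (inv h))" by (simp only: f)
  also have "\<dots> = (\<nu> h \<otimes>\<^bsub>Q\<^esub> beta (f * 1)) \<otimes>\<^bsub>Q\<^esub> \<nu> (inv h)" using c by (simp only: q.H.m_assoc)
  also have "\<dots> = beta (e * (f * 1)) \<otimes>\<^bsub>Q\<^esub> (\<nu> h \<otimes>\<^bsub>Q\<^esub> \<nu> (inv h))"
    unfolding e using c by (simp only: q.H.m_assoc)
  finally have "beta 1 = beta (e * f)" unfolding one using c by simp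
  then have "beta (e * f - 1) = \<one>\<^bsub>Q\<^esub>"
    using b beta_closed[of "e * f"] q.H.int_pow_diff[OF nu_closed[OF b], of "e * f" 1] by simp
  then have "e * f = 1" using inf[of "e * f - 1"] by fastforce
  then have "e = 1 \<or> e = -1" using zmult_eq_1_iff by blast
  then show ?thesis using e by auto
qed

lemma finite_index_M:
  obtains R where "finite R" "R \<subseteq> P" "\<And>g. g \<in> P \<Longrightarrow> \<exists>r\<in>R. \<exists>m\<in>M. g = r \<otimes> m"
proof -
  let ?f = "\<lambda>x. \<nu> x \<otimes>\<^bsub>Q\<^esub> \<nu> b \<otimes>\<^bsub>Q\<^esub> inv\<^bsub>Q\<^esub> \<nu> x"
  have "?f ` P \<subseteq> ?f ` H" by (auto simp: P_def)
  moreover have "finite (?f ` H)"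
  proof (cases "\<exists>n::int. n \<noteq> 0 \<and> beta n = \<one>\<^bsub>Q\<^esub>")
    case True
    then have "finite (range beta)" using q.H.finite_int_pow_range[OF nu_closed[OF b]] by blast
    moreover have "?f ` H \<subseteq> range beta" using normalizes by fastforce
    ultimately show ?thesis by (rule finite_subset[rotated])
  next
    case False
    have "?f h \<in> {beta 1, beta (-1)}" if h: "h \<in> H" for h
    proof -
      have hc: "\<nu> h \<in> carrier Q" "\<nu> b \<in> carrier Q" using nu_H[OF h] b by auto
      have *: "?f h = beta k" if "\<nu> h \<otimes>\<^bsub>Q\<^esub> beta 1 = beta k \<otimes>\<^bsub>Q\<^esub> \<nu> h" for k
        using that q.H.conj_eq_iff[OF hc beta_closed] hc by simp
      have "\<nu> h \<otimes>\<^bsub>Q\<^esub> beta 1 = beta 1 \<otimes>\<^bsub>Q\<^esub> \<nu> h \<or> \<nu> h \<otimes>\<^bsub>Q\<^esub> beta 1 = beta (-1) \<otimes>\<^bsub>Q\<^esub> \<nu> h"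
        using conj_infinite_order[OF h] False by blast
      then show ?thesis using *[of 1] *[of "-1"] by blast
    qed
    then have "?f ` H \<subseteq> {beta 1, beta (-1)}" by (rule image_subsetI)
    then show ?thesis by (rule finite_subset) simp
  qed
  ultimately have fin: "finite (?f ` P)" by (rule finite_subset)
  have P: "P \<subseteq> carrier G" by (auto simp: P_def)
  have tr: "inv x \<otimes> y \<in> M" if x: "x \<in> P" and y: "y \<in> P" and eq: "?f x = ?f y" for x y
  proof -
    have xc: "x \<in> carrier G" "y \<in> carrier G" using x y by (auto simp: P_def)
    have c: "\<nu> x \<in> carrier Q" "\<nu> y \<in> carrier Q" "\<nu> b \<in> carrier Q" using xc b by auto
    have "inv\<^bsub>Q\<^esub> \<nu> x \<otimes>\<^bsub>Q\<^esub> (?f x) \<otimes>\<^bsub>Q\<^esub> \<nu> y = inv\<^bsub>Q\<^esub> \<nu> x \<otimes>\<^bsub>Q\<^esub> (?f y) \<otimes>\<^bsub>Q\<^esub> \<nu> y"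
      by (simp only: eq)
    moreover have "inv\<^bsub>Q\<^esub> \<nu> x \<otimes>\<^bsub>Q\<^esub> (?f x) \<otimes>\<^bsub>Q\<^esub> \<nu> y
        = (inv\<^bsub>Q\<^esub> \<nu> x \<otimes>\<^bsub>Q\<^esub> \<nu> x) \<otimes>\<^bsub>Q\<^esub> \<nu> b \<otimes>\<^bsub>Q\<^esub> (inv\<^bsub>Q\<^esub> \<nu> x \<otimes>\<^bsub>Q\<^esub> \<nu> y)"
      using c by (simp only: q.H.m_assoc q.H.m_closed q.H.inv_closed)
    moreover have "inv\<^bsub>Q\<^esub> \<nu> x \<otimes>\<^bsub>Q\<^esub> (?f y) \<otimes>\<^bsub>Q\<^esub> \<nu> y
        = (inv\<^bsub>Q\<^esub> \<nu> x \<otimes>\<^bsub>Q\<^esub> \<nu> y) \<otimes>\<^bsub>Q\<^esub> \<nu> b \<otimes>\<^bsub>Q\<^esub> (inv\<^bsub>Q\<^esub> \<nu> y \<otimes>\<^bsub>Q\<^esub> \<nu> y)"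
      using c by (simp only: q.H.m_assoc q.H.m_closed q.H.inv_closed)
    ultimately have "\<nu> (inv x \<otimes> y) \<otimes>\<^bsub>Q\<^esub> \<nu> b = \<nu> b \<otimes>\<^bsub>Q\<^esub> \<nu> (inv x \<otimes> y)"
      using c xc by simp
    moreover have "inv x \<otimes> y \<in> P"
      using x y subgroup_P by (simp add: subgroup.m_closed subgroup.m_inv_closed)
    ultimately show ?thesis by (simp add: M_def)
  qed
  show thesis
    by (rule finite_transversal[OF fin _ P], rule tr, assumption+, rule that)
qed

text \<open>
  If a nonzero power of \<open>b\<close> lies in \<open>P\<close>, then \<open>P\<close>, and hence also \<open>M\<close>, has finite index in \<open>L\<close>.
\<close>

lemma finite_index_M_L:
  assumes l: "l \<noteq> (0::int)" "beta l \<in> \<nu> ` H"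
  obtains R where "finite R" "R \<subseteq> L" "\<And>g. g \<in> L \<Longrightarrow> \<exists>r\<in>R. \<exists>m\<in>M. g = r \<otimes> m"
proof -
  obtain R where R: "finite R" "R \<subseteq> P" "\<And>g. g \<in> P \<Longrightarrow> \<exists>r\<in>R. \<exists>m\<in>M. g = r \<otimes> m"
    by (rule finite_index_M) (rule that)
  let ?S = "(\<lambda>(s, r). b [^] s \<otimes> r) ` ({0..<\<bar>l\<bar>} \<times> R)"
  have "finite ?S" using R(1) by simp
  moreover have "?S \<subseteq> L"
    using R(2) P_sub_L b_pow_L subgroup.m_closed[OF subgroup_L] by auto
  moreover have "\<exists>r\<in>?S. \<exists>m\<in>M. g = r \<otimes> m" if g: "g \<in> L" for g
  proof -
    obtain k h where gc: "g \<in> carrier G" and h: "h \<in> H" and ng: "\<nu> g = beta k \<otimes>\<^bsub>Q\<^esub> \<nu> h"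
      using g by (auto simp: L_def)
    let ?s = "k mod \<bar>l\<bar>"
    have "beta \<bar>l\<bar> \<in> \<nu> ` H"
    proof (cases "l \<ge> 0")
      case False
      have "beta (- l) = inv\<^bsub>Q\<^esub> beta l" using b by (simp add: q.H.int_pow_neg)
      then show ?thesis using False image_H_closed(2)[OF l(2)] by simp
    qed (use l in simp)
    then have "beta \<bar>l\<bar> [^]\<^bsub>Q\<^esub> (k div \<bar>l\<bar>) \<in> \<nu> ` H"
      using q.H.subgroup_int_pow_closed[OF q.subgroup_img_is_subgroup[OF subgroup_H]] by blast
    then have 1: "beta (\<bar>l\<bar> * (k div \<bar>l\<bar>)) \<in> \<nu> ` H" using b by (simp add: q.H.int_pow_pow)
    let ?y = "inv (b [^] ?s) \<otimes> g"
    note c = gc b beta_closed nu_H[OF h]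
    have "\<nu> ?y = inv\<^bsub>Q\<^esub> beta ?s \<otimes>\<^bsub>Q\<^esub> (beta (?s + \<bar>l\<bar> * (k div \<bar>l\<bar>)) \<otimes>\<^bsub>Q\<^esub> \<nu> h)"
      using c by (simp add: ng nu_b_pow)
    also have "\<dots> = (inv\<^bsub>Q\<^esub> beta ?s \<otimes>\<^bsub>Q\<^esub> beta ?s) \<otimes>\<^bsub>Q\<^esub> (beta (\<bar>l\<bar> * (k div \<bar>l\<bar>)) \<otimes>\<^bsub>Q\<^esub> \<nu> h)"
      unfolding beta_add using c by (simp only: q.H.m_assoc q.H.m_closed q.H.inv_closed)
    finally have "\<nu> ?y = beta (\<bar>l\<bar> * (k div \<bar>l\<bar>)) \<otimes>\<^bsub>Q\<^esub> \<nu> h" using c by simp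
    then have "?y \<in> P" using c image_H_closed(1)[OF 1 imageI[OF h]] by (simp add: P_def)
    then obtain r m where rm: "r \<in> R" "m \<in> M" "?y = r \<otimes> m" using R(3) by blast
    have rc: "r \<in> carrier G" "m \<in> carrier G"
      using rm R(2) subgroup.mem_carrier[OF subgroup_P] M_sub_P by auto
    have "g = b [^] ?s \<otimes> ?y" using c by (simp add: m_assoc[symmetric])
    then have "g = (b [^] ?s \<otimes> r) \<otimes> m" using rm(3) c rc by (simp add: m_assoc)
    moreover have "b [^] ?s \<otimes> r \<in> ?S" using rm(1) l(1) by force
    ultimately show ?thesis using rm(2) by blast
  qed
  ultimately show thesis by (rule that)
qed

end

section \<open>Irreducibility of the extended representation\<close>

context cyclic_step
begin

lemma M_carrier: "M \<subseteq> carrier G" and P_carrier: "P \<subseteq> carrier G" and L_carrier: "L \<subseteq> carrier G"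
  using subgroup.subset[OF subgroup_M] subgroup.subset[OF subgroup_P] subgroup.subset[OF subgroup_L] .

lemma delta_in: "H \<subseteq> A \<Longrightarrow> delta \<in> supported A"
  using delta_ind by (auto simp: supported_def delta_def)

text \<open>Since \<open>P = HM\<close> and \<open>H\<close> acts on \<open>delta\<close> by scalars, \<open>delta\<close> generates already under \<open>M\<close>.\<close>

lemma supported_P_cyclic:
  assumes Y: "rep.invariant M Y" "delta \<in> Y"
  shows "supported P \<subseteq> Y"
proof (rule supported_subset[OF rep.invariantD(1)[OF Y(1)] _ P_carrier])
  fix x assume "x \<in> P"
  then obtain h m where x: "h \<in> H" "m \<in> M" "x = h \<otimes> m" by (rule P_decomp)
  have m: "m \<in> carrier G" "inv m \<in> M"
    using x(2) M_carrier subgroup.m_inv_closed[OF subgroup_M] by auto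
  have "act (inv x) delta = act (inv m) (sc (\<chi> (inv h)) delta)"
    using m x H_carrier[OF x(1)] delta_ind by (simp add: inv_mult_group rep.mult act_delta H_closed(2))
  also have "\<dots> \<in> Y"
    using rep.invariantD(4,8)[OF Y(1)] m(2) Y(2) by blast
  finally show "act (inv x) delta \<in> Y" .
qed

lemma supported_L_subset:
  assumes Y: "rep.subspace Y"
    and gen: "\<And>m k. m \<in> M \<Longrightarrow> act m (act (b [^] (k::int)) delta) \<in> Y"
  shows "supported L \<subseteq> Y"
proof (rule supported_subset[OF Y _ L_carrier])
  fix x assume "x \<in> L"
  then have "inv x \<in> L" by (rule subgroup.m_inv_closed[OF subgroup_L])
  then obtain h m k where x: "h \<in> H" "m \<in> M" "inv x = m \<otimes> b [^] (k::int) \<otimes> h" by (rule L_decomp)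
  have c: "m \<in> carrier G" "h \<in> carrier G" "b [^] k \<in> carrier G"
    using x M_carrier H_carrier b by auto
  have bd: "act (b [^] k) delta \<in> ind" using c delta_ind by (intro rep.closed)
  have "act (inv x) delta = act m (act (b [^] k) (sc (\<chi> h) delta))"
    using c x(1) delta_ind rep.subspace_scale[OF rep.space delta_ind]
    by (simp add: x(3) rep.mult act_delta)
  also have "\<dots> = sc (\<chi> h) (act m (act (b [^] k) delta))"
    using c delta_ind bd by (simp add: rep.scale)
  also have "\<dots> \<in> Y"
    using gen[OF x(2)] by (rule rep.subspace_scale[OF Y])
  finally show "act (inv x) delta \<in> Y" .
qed

lemma supported_L_cyclic:
  assumes Y: "rep.invariant L Y" "delta \<in> Y"
  shows "supported L \<subseteq> Y"
proof (rule supported_L_subset[OF rep.invariantD(1)[OF Y(1)]])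
  fix m and k :: int assume "m \<in> M"
  then show "act m (act (b [^] k) delta) \<in> Y"
    using rep.invariantD(4)[OF Y(1)] Y(2) b_pow_L M_sub_P P_sub_L by blast
qed

lemma supported_mono: "A \<subseteq> B \<Longrightarrow> supported A \<subseteq> supported B"
  by (auto simp: supported_def)

text \<open>
  If \<open>supported P\<close> is simple for \<open>P\<close>, then \<open>supported L\<close> is completely reducible for \<open>M\<close>: it is
  the sum of the translates by \<open>L\<close> of a simple subspace for \<open>M\<close> of \<open>supported P\<close>.
\<close>

lemma exists_M_projection:
  assumes simple: "rep.simple P (supported P)" and U: "rep.invariant M U" "U \<subseteq> supported L"
  obtains p where "rep.equivariant M (supported L) p" "\<And>v. v \<in> supported L \<Longrightarrow> p v \<in> U"
    "\<And>u. u \<in> U \<Longrightarrow> p u = u"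
proof -
  have sW: "\<And>Y. \<lbrakk>rep.invariant P Y; Y \<subseteq> supported P\<rbrakk> \<Longrightarrow> Y = {0} \<or> Y = supported P"
    using simple by (auto simp: rep.simple_def)
  have iE: "rep.invariant L (supported L)" by (rule supported_invariant[OF subgroup_L])
  obtain R where R: "finite R" "R \<subseteq> P" "\<And>g. g \<in> P \<Longrightarrow> \<exists>r\<in>R. \<exists>m\<in>M. g = r \<otimes> m"
    by (rule finite_index_M) (rule that)
  have norm: "inv g \<otimes> m \<otimes> g \<in> M" if "g \<in> P" "m \<in> M" for g m
    using that P_sub_L by (intro M_normal) auto
  obtain X where X: "rep.simple M X" "X \<subseteq> supported P"
    by (rule rep.exists_simple_in_cyclic[OF subgroup_P subgroup_M M_sub_P norm R simple
          delta_in[OF H_sub_P] supported_P_cyclic])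
  have iX: "rep.invariant M X" and X0: "X \<noteq> {0}" using X(1) by (auto simp: rep.simple_def)
  note Xi = rep.invariantD(3)[OF iX]
  define tr where "tr A = (\<Union>g\<in>A. act g ` X)" for A
  have tr_inv: "rep.invariant A (rep.span (tr A))" if A: "subgroup A G" for A
  proof (rule rep.invariant_span)
    show Ac: "A \<subseteq> carrier G" using A by (rule subgroup.subset)
    show "tr A \<subseteq> ind" using rep.closed Xi Ac by (auto simp: tr_def)
    fix g s assume g: "g \<in> A" and "s \<in> tr A"
    then obtain a x where s: "a \<in> A" "x \<in> X" "s = act a x" by (auto simp: tr_def)
    have "act g s = act (g \<otimes> a) x"
      using Xi[OF s(2)] g s(1) Ac by (simp add: s(3) rep.mult subset_iff)
    moreover have "g \<otimes> a \<in> A" using A g s(1) by (rule subgroup.m_closed)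
    ultimately have "act g s \<in> tr A" using s(2) by (auto simp: tr_def)
    then show "act g s \<in> rep.span (tr A)" by (rule rep.span_base)
  qed
  have trP: "tr P \<subseteq> supported P"
    using X(2) rep.invariantD(4)[OF supported_invariant[OF subgroup_P]] by (auto simp: tr_def)
  have "X \<subseteq> tr P"
  proof
    fix x assume "x \<in> X"
    then have "x = act \<one> x" using Xi by (simp add: rep.one)
    then show "x \<in> tr P" using \<open>x \<in> X\<close> subgroup.one_closed[OF subgroup_P] unfolding tr_def by blast
  qed
  then have "X \<subseteq> rep.span (tr P)" using rep.span_superset by blast
  then have "rep.span (tr P) \<noteq> {0}" using X0 rep.invariantD(5)[OF iX] by blast
  moreover have "rep.span (tr P) \<subseteq> supported P"
    using trP rep.invariantD(1)[OF supported_invariant[OF subgroup_P]] by (rule rep.span_minimal)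
  ultimately have "rep.span (tr P) = supported P"
    using sW[OF tr_inv[OF subgroup_P]] by blast
  then have "delta \<in> rep.span (tr P)" using delta_in[OF H_sub_P] by simp
  moreover have "rep.span (tr P) \<subseteq> rep.span (tr L)"
    using P_sub_L by (intro rep.span_mono) (auto simp: tr_def)
  ultimately have "delta \<in> rep.span (tr L)" by blast
  then have sub: "supported L \<subseteq> rep.span (\<Union>((\<lambda>g. act g ` X) ` L))"
    using supported_L_cyclic[OF tr_inv[OF subgroup_L]] by (simp add: tr_def)
  have simples: "rep.simple M Z \<and> Z \<subseteq> supported L" if Z: "Z \<in> (\<lambda>g. act g ` X) ` L" for Z
  proof -
    obtain g where g: "g \<in> L" "Z = act g ` X" using Z by blast
    have "rep.simple M Z"
      unfolding g(2) using g(1) L_carrier M_normal[OF g(1)] M_normal'[OF g(1)]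
      by (intro rep.simple_translate[OF M_carrier _ X(1)]) auto
    moreover have "X \<subseteq> supported L" using X(2) supported_mono[OF P_sub_L] by blast
    then have "Z \<subseteq> supported L" using rep.invariantD(4)[OF iE g(1)] g(2) by blast
    ultimately show ?thesis by blast
  qed
  have "M \<subseteq> L" using M_sub_P P_sub_L by blast
  from rep.invariant_mono[OF iE this] have iME: "rep.invariant M (supported L)" .
  show thesis
    by (rule rep.exists_equivariant_projection[OF M_carrier iME U simples sub]) (assumption | rule that)+
qed

lemma subset_from_delta:
  assumes U: "rep.invariant L U" "U \<subseteq> supported L" and d: "sc c delta \<in> U" "c \<noteq> 0"
  shows "U = supported L"
proof -
  have "sc (inverse c) (sc c delta) \<in> U" using U(1) d(1) by (rule rep.invariantD(8))
  then have "delta \<in> U" using d(2) by (simp add: rep.scale_scale)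
  then show ?thesis using supported_L_cyclic[OF U(1)] U(2) by blast
qed

lemma kernel_subspace:
  assumes p: "rep.equivariant K E p" and E: "rep.subspace E"
  shows "rep.subspace {v \<in> E. p v = 0}"
proof (rule rep.subspaceI)
  have "p (sc 0 0) = sc 0 (p 0)" using rep.subspace_0[OF E] by (rule rep.equivariantD(2)[OF p])
  then have "p 0 = 0" by (simp only: rep.scale_zero_left)
  then show "0 \<in> {v \<in> E. p v = 0}" using rep.subspace_0[OF E] by (intro CollectI conjI)
  show "v + w \<in> {v \<in> E. p v = 0}" if "v \<in> {v \<in> E. p v = 0}" "w \<in> {v \<in> E. p v = 0}" for v w
    using that rep.equivariantD(1)[OF p] rep.subspace_add[OF E] by simp
  show "sc c v \<in> {v \<in> E. p v = 0}" if "v \<in> {v \<in> E. p v = 0}" for c v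
    using that rep.equivariantD(2)[OF p] rep.subspace_scale[OF E] by simp
qed

text \<open>
  If \<open>M\<close> has finite index in \<open>L\<close>, averaging a projection onto \<open>U\<close> gives an endomorphism \<open>q\<close> of
  \<open>supported L\<close> with image in \<open>U\<close> that is a nonzero scalar on \<open>U\<close>.  As \<open>q delta\<close> is a multiple of
  \<open>delta\<close>, either \<open>U\<close> contains \<open>delta\<close> or \<open>q\<close> vanishes.
\<close>

lemma irreducible_finite_index:
  assumes eig: "\<And>v. \<lbrakk>v \<in> ind; \<And>h. h \<in> H \<Longrightarrow> act h v = sc (\<chi> h) v\<rbrakk> \<Longrightarrow> \<exists>c. v = sc c delta"
    and simple: "rep.simple P (supported P)"
    and l: "l \<noteq> (0::int)" "beta l \<in> \<nu> ` H"
    and U: "rep.invariant L U" "U \<subseteq> supported L"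
  shows "U = {0} \<or> U = supported L"
proof -
  have iE: "rep.invariant L (supported L)" by (rule supported_invariant[OF subgroup_L])
  have M_L: "M \<subseteq> L" using M_sub_P P_sub_L by blast
  have HL: "H \<subseteq> L" using H_sub_P P_sub_L by blast
  obtain p where p: "rep.equivariant M (supported L) p" "\<And>v. v \<in> supported L \<Longrightarrow> p v \<in> U"
    "\<And>u. u \<in> U \<Longrightarrow> p u = u"
    by (rule exists_M_projection[OF simple rep.invariant_mono[OF U(1) M_L] U(2)]) (rule that)
  obtain R where R: "finite R" "R \<subseteq> L" "\<And>g. g \<in> L \<Longrightarrow> \<exists>r\<in>R. \<exists>m\<in>M. g = r \<otimes> m"
    by (rule finite_index_M_L[OF l]) (rule that)
  obtain q and n :: nat where n: "n \<noteq> 0" and q: "rep.equivariant L (supported L) q"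
    "\<And>v. v \<in> supported L \<Longrightarrow> q v \<in> U" "\<And>u. u \<in> U \<Longrightarrow> q u = sc (of_nat n) u"
    by (rule rep.exists_average[OF subgroup_L M_L R iE U p]) (assumption | rule that)+
  have d: "delta \<in> supported L" by (rule delta_in[OF HL])
  have qd: "q delta \<in> U" by (rule q(2)[OF d])
  have "act h (q delta) = sc (\<chi> h) (q delta)" if h: "h \<in> H" for h
    using rep.equivariantD(3)[OF q(1) subsetD[OF HL h] d] rep.equivariantD(2)[OF q(1) d]
    by (simp add: act_delta[OF h])
  then obtain c where c: "q delta = sc c delta"
    using eig[OF rep.invariantD(3)[OF U(1) qd]] by blast
  show ?thesis
  proof (cases "c = 0")
    case True
    then have q0: "q delta = 0" unfolding c by (simp only: rep.scale_zero_left)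
    let ?K = "{v \<in> supported L. q v = 0}"
    have "rep.invariant L ?K"
      unfolding rep.invariant_def
    proof (intro conjI ballI)
      show "rep.subspace ?K" by (rule kernel_subspace[OF q(1) rep.invariantD(1)[OF iE]])
      show "?K \<subseteq> ind" using rep.invariantD(2)[OF iE] by blast
      show "act g v \<in> ?K" if "g \<in> L" "v \<in> ?K" for g v
        using that rep.equivariantD(3)[OF q(1)] rep.invariantD(4)[OF iE]
          rep.rep_zero[OF subsetD[OF L_carrier that(1)]] by simp
    qed
    moreover have "delta \<in> ?K" using d q0 by (intro CollectI conjI)
    ultimately have K: "supported L \<subseteq> ?K" by (rule supported_L_cyclic)
    have "u = 0" if u: "u \<in> U" for u
    proof -
      have "sc (of_nat n) u = 0" using K U(2) u q(3)[OF u] by auto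
      then show ?thesis using n by (simp add: rep.scale_eq_0_iff)
    qed
    then show ?thesis using rep.invariantD(5)[OF U(1)] by blast
  next
    case False
    then show ?thesis using subset_from_delta[OF U] qd c by simp
  qed
qed

text \<open>
  Suppose that no nonzero power of \<open>b\<close> lies in \<open>P\<close>.  The elements of \<open>H\<close> outside \<open>M\<close>, if any, then
  invert \<open>b\<close> modulo the kernel, and \<open>M\<close> meets \<open>H\<close> in a subgroup of index at most two.  Let \<open>f\<close> be
  the component of \<open>u\<close> on the coset of the \<open>l\<close>-th power of \<open>b\<close>, where \<open>l\<close> is nonzero.  If \<open>M\<close>
  contains \<open>H\<close>, then \<open>f\<close> is an eigenvector of \<open>H\<close>; otherwise the sum of \<open>f\<close> and a mirror image
  of \<open>f\<close>, supported on the coset of the power \<open>-l\<close>, is one.  The two supports are disjoint and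
  avoid \<open>H\<close>, whence \<open>f = 0\<close>.
\<close>

lemma eigenvector_supported_P:
  assumes eig: "\<And>v. \<lbrakk>v \<in> ind; \<And>h. h \<in> H \<Longrightarrow> act h v = sc (\<chi> h) v\<rbrakk> \<Longrightarrow> \<exists>c. v = sc c delta"
    and inf: "\<And>l::int. l \<noteq> 0 \<Longrightarrow> beta l \<notin> \<nu> ` H"
    and u: "u \<in> supported L" and uM: "\<And>c. \<lbrakk>c \<in> H; c \<in> M\<rbrakk> \<Longrightarrow> act c u = sc (\<chi> c) u"
  shows "u \<in> supported P"
proof -
  have ui: "u \<in> ind" and uL: "\<And>x. x \<notin> L \<Longrightarrow> u x = 0" using u by (auto simp: supported_def)
  have eig0: "w x = 0" if w: "w \<in> ind" "\<And>h. h \<in> H \<Longrightarrow> act h w = sc (\<chi> h) w" and x: "x \<notin> H" for w x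
  proof -
    obtain c where "w = sc c delta" using eig[OF w] by blast
    then show ?thesis using x by (simp add: pointwise_scale_def delta_def)
  qed
  have beta_ne: "beta n \<noteq> \<one>\<^bsub>Q\<^esub>" if "n \<noteq> 0" for n using inf[OF that] image_H_closed(3) by metis
  have "u x = 0" if xP: "x \<notin> P" for x
  proof (cases "x \<in> L")
    case xL: True
    have xH: "x \<notin> H" using xP H_sub_P by blast
    have xc: "x \<in> carrier G" using xL L_carrier by blast
    obtain k h where h: "h \<in> H" and nx: "\<nu> x = beta k \<otimes>\<^bsub>Q\<^esub> \<nu> h" using xL by (auto simp: L_def)
    obtain h' where h': "h' \<in> H" and nh': "\<nu> h' = inv\<^bsub>Q\<^esub> \<nu> h"
      using h H_closed(2) H_carrier by (metis q.hom_inv)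
    obtain e :: int where e: "\<And>k. \<nu> h' \<otimes>\<^bsub>Q\<^esub> beta k = beta (e * k) \<otimes>\<^bsub>Q\<^esub> \<nu> h'"
      using nu_H_beta[OF h'] by blast
    \<comment> \<open>Moving the power of \<open>b\<close> to the right of the element of \<open>H\<close> changes the exponent.\<close>
    define l where "l = e * k"
    note cQ = nu_H[OF h] nu_H[OF h'] beta_closed
    have nx': "\<nu> x = \<nu> h \<otimes>\<^bsub>Q\<^esub> beta l"
    proof -
      have "\<nu> h \<otimes>\<^bsub>Q\<^esub> (\<nu> h' \<otimes>\<^bsub>Q\<^esub> beta k) \<otimes>\<^bsub>Q\<^esub> \<nu> h = \<nu> h \<otimes>\<^bsub>Q\<^esub> beta l \<otimes>\<^bsub>Q\<^esub> (\<nu> h' \<otimes>\<^bsub>Q\<^esub> \<nu> h)"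
        unfolding e l_def using cQ by (simp only: q.H.m_assoc q.H.m_closed)
      moreover have "\<nu> h \<otimes>\<^bsub>Q\<^esub> (\<nu> h' \<otimes>\<^bsub>Q\<^esub> beta k) \<otimes>\<^bsub>Q\<^esub> \<nu> h = (\<nu> h \<otimes>\<^bsub>Q\<^esub> \<nu> h') \<otimes>\<^bsub>Q\<^esub> (beta k \<otimes>\<^bsub>Q\<^esub> \<nu> h)"
        using cQ by (simp only: q.H.m_assoc q.H.m_closed)
      ultimately show ?thesis using cQ nx by (simp add: nh')
    qed
    have l0: "l \<noteq> 0"
    proof
      assume "l = 0"
      then have "\<nu> x = \<nu> h" using nx' cQ by simp
      then show False using xP xc h by (auto simp: P_def)
    qed
    \<comment> \<open>\<open>A\<close> is the coset of \<open>P\<close> containing \<open>x\<close>, and \<open>f\<close> is the component of \<open>u\<close> on it.\<close>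
    define A where "A = {y \<in> carrier G. \<exists>h\<in>H. \<nu> y = \<nu> h \<otimes>\<^bsub>Q\<^esub> beta l}"
    have Ac: "A \<subseteq> carrier G" by (auto simp: A_def)
    have HA: "g \<otimes> y \<in> A" if g: "g \<in> H" and y: "y \<in> A" for g y
    proof -
      obtain a where a: "y \<in> carrier G" "a \<in> H" "\<nu> y = \<nu> a \<otimes>\<^bsub>Q\<^esub> beta l" using y by (auto simp: A_def)
      have "\<nu> (g \<otimes> y) = \<nu> (g \<otimes> a) \<otimes>\<^bsub>Q\<^esub> beta l"
        using a g H_carrier cQ by (simp add: q.H.m_assoc)
      then show ?thesis using a g H_carrier H_closed(3)[OF g a(2)] unfolding A_def by blast
    qed
    define f where "f = restr A u"
    have fi: "f \<in> ind" unfolding f_def by (rule restr_ind[OF ui Ac HA])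
    have xA: "x \<in> A" using xc h nx' by (auto simp: A_def)
    then have fx: "f x = u x" by (simp add: f_def restr_def)
    have fM: "act c f = sc (\<chi> c) f" if c: "c \<in> H" "c \<in> M" for c
    proof
      fix y
      have cc: "c \<in> carrier G" using H_carrier[OF c(1)] .
      have bc: "\<nu> c \<otimes>\<^bsub>Q\<^esub> beta l = beta l \<otimes>\<^bsub>Q\<^esub> \<nu> c"
        using c(2) b cc by (intro q.H.commute_int_pow) (auto simp: M_def)
      have Ac': "y \<otimes> a \<in> A"
        if y: "y \<in> A" and a: "a \<in> H" and ba: "\<nu> a \<otimes>\<^bsub>Q\<^esub> beta l = beta l \<otimes>\<^bsub>Q\<^esub> \<nu> a" for y a
      proof -
        obtain g where g: "y \<in> carrier G" "g \<in> H" "\<nu> y = \<nu> g \<otimes>\<^bsub>Q\<^esub> beta l" using y by (auto simp: A_def)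
        have "\<nu> (y \<otimes> a) = \<nu> g \<otimes>\<^bsub>Q\<^esub> (\<nu> a \<otimes>\<^bsub>Q\<^esub> beta l)"
          unfolding ba using g nu_H[OF g(2)] nu_H[OF a] H_carrier[OF a] cQ by (simp add: q.H.m_assoc)
        also have "\<dots> = \<nu> (g \<otimes> a) \<otimes>\<^bsub>Q\<^esub> beta l"
          using H_carrier[OF g(2)] H_carrier[OF a] cQ by (simp add: q.H.m_assoc)
        finally show ?thesis
          using g(1) H_carrier[OF a] H_closed(3)[OF g(2) a] unfolding A_def by blast
      qed
      have bc': "\<nu> (inv c) \<otimes>\<^bsub>Q\<^esub> beta l = beta l \<otimes>\<^bsub>Q\<^esub> \<nu> (inv c)"
        using subgroup.m_inv_closed[OF subgroup_M c(2)] b cc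
        by (intro q.H.commute_int_pow) (auto simp: M_def)
      have iff: "y \<otimes> c \<in> A \<longleftrightarrow> y \<in> A" if "y \<in> carrier G"
      proof
        assume "y \<otimes> c \<in> A"
        from Ac'[OF this H_closed(2)[OF c(1)] bc'] show "y \<in> A"
          using that cc by (simp add: m_assoc)
      qed (rule Ac'[OF _ c(1) bc])
      show "act c f y = sc (\<chi> c) f y"
      proof (cases "y \<in> carrier G")
        case True
        then show ?thesis
          using iff fun_cong[OF uM[OF c], of y] by (simp add: act_apply f_def restr_def pointwise_scale_def)
      next
        case False
        then show ?thesis using Ac by (auto simp: ind_action_def f_def restr_def pointwise_scale_def)
      qed
    qed
    show "u x = 0"
    proof (cases "H \<subseteq> M")
      case True
      then show ?thesis using eig0[OF fi fM xH] fx by auto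
    next
      case False
      then obtain t where t: "t \<in> H" "t \<notin> M" by blast
      note tc = H_carrier[OF t(1)]
      have dich: "a \<in> M \<or> (\<forall>k. \<nu> a \<otimes>\<^bsub>Q\<^esub> beta k = beta (- k) \<otimes>\<^bsub>Q\<^esub> \<nu> a)" if a: "a \<in> H" for a
      proof -
        have "a \<in> M" if "\<forall>k. \<nu> a \<otimes>\<^bsub>Q\<^esub> beta k = beta k \<otimes>\<^bsub>Q\<^esub> \<nu> a"
          using spec[OF that, of 1] a b H_sub_P by (auto simp: M_def)
        then show ?thesis using conj_infinite_order[OF a beta_ne] by blast
      qed
      then have tb: "\<nu> t \<otimes>\<^bsub>Q\<^esub> beta k = beta (- k) \<otimes>\<^bsub>Q\<^esub> \<nu> t" for k using t by blast
      have prodM: "a \<otimes> d \<in> M" if a: "a \<in> H" "a \<notin> M" and d: "d \<in> H" "d \<notin> M" for a d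
      proof -
        have c: "\<nu> a \<in> carrier Q" "\<nu> d \<in> carrier Q" "a \<in> carrier G" "d \<in> carrier G"
          using a d nu_H H_carrier by auto
        have ab: "\<nu> a \<otimes>\<^bsub>Q\<^esub> beta k = beta (- k) \<otimes>\<^bsub>Q\<^esub> \<nu> a" for k using dich[OF a(1)] a(2) by blast
        have db: "\<nu> d \<otimes>\<^bsub>Q\<^esub> beta k = beta (- k) \<otimes>\<^bsub>Q\<^esub> \<nu> d" for k using dich[OF d(1)] d(2) by blast
        have "\<nu> a \<otimes>\<^bsub>Q\<^esub> \<nu> d \<otimes>\<^bsub>Q\<^esub> beta 1 = \<nu> a \<otimes>\<^bsub>Q\<^esub> beta (- 1) \<otimes>\<^bsub>Q\<^esub> \<nu> d"
          using c beta_closed by (simp only: q.H.m_assoc db q.H.m_closed)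
        also have "\<dots> = beta (- (- 1)) \<otimes>\<^bsub>Q\<^esub> (\<nu> a \<otimes>\<^bsub>Q\<^esub> \<nu> d)"
          unfolding ab using c beta_closed by (simp only: q.H.m_assoc q.H.m_closed)
        finally have "\<nu> (a \<otimes> d) \<otimes>\<^bsub>Q\<^esub> \<nu> b = \<nu> b \<otimes>\<^bsub>Q\<^esub> \<nu> (a \<otimes> d)" using c b by simp
        then show ?thesis using H_closed(3)[OF a(1) d(1)] H_sub_P by (auto simp: M_def)
      qed
      have it: "inv t \<in> H" "inv t \<notin> M"
        using t H_closed(2) subgroup.m_inv_closed[OF subgroup_M, of "inv t"] tc by auto
      define s where "s = inverse (\<chi> t)"
      have s: "s * \<chi> t = 1" using char_nonzero[OF t(1)] by (simp add: s_def)
      \<comment> \<open>The scalar \<open>s\<close> makes \<open>t\<close>, which exchanges the two summands up to scalars, act on \<open>w\<close> by \<open>\<chi> t\<close>.\<close>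
      define w where "w = f + sc s (act t f)"
      have tfi: "act t f \<in> ind" using tc fi by (rule rep.closed)
      have stf: "sc s (act t f) \<in> ind" using rep.space tfi by (rule rep.subspace_scale)
      have wi: "w \<in> ind" unfolding w_def using rep.space fi stf by (rule rep.subspace_add)
      have wM: "act c w = sc (\<chi> c) w" if c: "c \<in> H" "c \<in> M" for c
      proof -
        have cc: "c \<in> carrier G" using H_carrier[OF c(1)] .
        let ?d = "inv t \<otimes> c \<otimes> t"
        have d: "?d \<in> H" "?d \<in> M"
          using c t it(1) H_closed(3) M_normal[of t c] H_sub_P P_sub_L by auto
        have "\<chi> ?d = \<chi> (inv t) * \<chi> c * \<chi> t"
          using c t it(1) H_closed(3) by (simp add: char_mult)
        then have \<chi>d: "\<chi> ?d = \<chi> c" using char_inv[OF t(1)] by (simp add: mult.commute mult.left_commute)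
        have "act c (act t f) = act t (sc (\<chi> c) f)"
          using rep.rep_conj[OF tc cc fi] fM[OF d] \<chi>d by simp
        then have "act c (act t f) = sc (\<chi> c) (act t f)"
          using rep.scale[OF tc fi] by simp
        then show ?thesis
          unfolding w_def using rep.add[OF cc fi stf] rep.scale[OF cc tfi] fM[OF c]
          by (simp add: rep.scale_right_distrib rep.scale_scale mult.commute)
      qed
      have wt: "act t w = sc (\<chi> t) w"
      proof -
        have "act t (act t f) = act (t \<otimes> t) f" using tc fi by (simp add: rep.mult)
        also have "\<dots> = sc (\<chi> t * \<chi> t) f"
          using fM[OF H_closed(3)[OF t(1) t(1)] prodM[OF t t]] char_mult[OF t(1) t(1)] by simp
        finally have tt: "act t (act t f) = sc (\<chi> t * \<chi> t) f" .
        have "act t w = act t f + sc (s * (\<chi> t * \<chi> t)) f"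
          unfolding w_def using rep.add[OF tc fi stf] rep.scale[OF tc tfi] tt
          by (simp add: rep.scale_scale)
        also have "s * (\<chi> t * \<chi> t) = \<chi> t" using s by (simp add: mult.assoc[symmetric])
        also have "act t f + sc (\<chi> t) f = sc (\<chi> t) w"
          unfolding w_def using s by (simp add: rep.scale_right_distrib rep.scale_scale mult.commute add.commute)
        finally show ?thesis .
      qed
      have "act a w = sc (\<chi> a) w" if a: "a \<in> H" for a
      proof (cases "a \<in> M")
        case True
        then show ?thesis using wM a by blast
      next
        case aM: False
        let ?c = "inv t \<otimes> a"
        have ac: "a \<in> carrier G" using H_carrier[OF a] .
        have c: "?c \<in> H" "?c \<in> M" using H_closed(3)[OF it(1) a] prodM[OF it a aM] .
        have eq: "a = t \<otimes> ?c" using tc ac by (simp add: m_assoc[symmetric])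
        have "act a w = act t (act ?c w)"
          by (subst eq) (use tc ac wi in \<open>simp add: rep.mult\<close>)
        also have "\<dots> = sc (\<chi> ?c) (sc (\<chi> t) w)"
          using wM[OF c] rep.scale[OF tc wi] wt by simp
        also have "\<dots> = sc (\<chi> a) w"
          using char_mult[OF t(1) c(1)] eq by (simp add: rep.scale_scale mult.commute)
        finally show ?thesis .
      qed
      then have "w x = 0" by (rule eig0[OF wi _ xH])
      moreover have "f (x \<otimes> t) = 0"
      proof -
        have "x \<otimes> t \<notin> A"
        proof
          assume "x \<otimes> t \<in> A"
          then obtain a where a: "a \<in> H" "\<nu> (x \<otimes> t) = \<nu> a \<otimes>\<^bsub>Q\<^esub> beta l" by (auto simp: A_def)
          note ca = nu_H[OF a(1)] nu_H[OF t(1)] cQ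
          have "beta l \<otimes>\<^bsub>Q\<^esub> \<nu> t = \<nu> t \<otimes>\<^bsub>Q\<^esub> beta (- l)" using tb[of "- l"] by simp
          then have "\<nu> (x \<otimes> t) = \<nu> (h \<otimes> t) \<otimes>\<^bsub>Q\<^esub> beta (- l)"
            using xc tc nx' ca H_carrier[OF h] by (simp add: q.H.m_assoc)
          then have eq: "\<nu> a \<otimes>\<^bsub>Q\<^esub> beta l = \<nu> (h \<otimes> t) \<otimes>\<^bsub>Q\<^esub> beta (- l)" using a(2) by simp
          have ht: "h \<otimes> t \<in> H" using H_closed(3)[OF h t(1)] .
          have "inv\<^bsub>Q\<^esub> \<nu> a \<otimes>\<^bsub>Q\<^esub> (\<nu> a \<otimes>\<^bsub>Q\<^esub> beta l) \<otimes>\<^bsub>Q\<^esub> beta l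
              = inv\<^bsub>Q\<^esub> \<nu> a \<otimes>\<^bsub>Q\<^esub> (\<nu> (h \<otimes> t) \<otimes>\<^bsub>Q\<^esub> beta (- l)) \<otimes>\<^bsub>Q\<^esub> beta l"
            by (simp only: eq)
          then have "(inv\<^bsub>Q\<^esub> \<nu> a \<otimes>\<^bsub>Q\<^esub> \<nu> a) \<otimes>\<^bsub>Q\<^esub> (beta l \<otimes>\<^bsub>Q\<^esub> beta l)
              = (inv\<^bsub>Q\<^esub> \<nu> a \<otimes>\<^bsub>Q\<^esub> \<nu> (h \<otimes> t)) \<otimes>\<^bsub>Q\<^esub> (beta (- l) \<otimes>\<^bsub>Q\<^esub> beta l)"
            using ca nu_H[OF ht] by (simp only: q.H.m_assoc q.H.m_closed q.H.inv_closed)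
          then have "beta (l + l) = inv\<^bsub>Q\<^esub> \<nu> a \<otimes>\<^bsub>Q\<^esub> \<nu> (h \<otimes> t)"
            using ca nu_H[OF ht] b by (simp only: beta_add[symmetric] q.H.l_inv) simp
          then have "beta (l + l) \<in> \<nu> ` H"
            using image_H_closed(1)[OF image_H_closed(2)[OF imageI[OF a(1)]] imageI[OF ht]] by simp
          then show False using inf[of "l + l"] l0 by simp
        qed
        then show ?thesis by (simp add: f_def restr_def)
      qed
      ultimately show ?thesis
        using fx xc by (simp add: w_def pointwise_scale_def act_apply)
    qed
  qed (rule uL)
  then show ?thesis using ui by (simp add: supported_def)
qed

text \<open>
  In the infinite case every projection \<open>p\<close> onto \<open>U\<close> that is equivariant for \<open>M\<close> preserves each
  translate of \<open>supported P\<close> by a power of \<open>b\<close>, because conjugating \<open>p\<close> by that power and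
  evaluating at \<open>delta\<close> gives an eigenvector of \<open>H \<inter> M\<close>.  If \<open>U\<close> meets \<open>supported P\<close> only in
  \<open>0\<close>, then \<open>p = 0\<close>.
\<close>

lemma irreducible_infinite_index:
  assumes eig: "\<And>v. \<lbrakk>v \<in> ind; \<And>h. h \<in> H \<Longrightarrow> act h v = sc (\<chi> h) v\<rbrakk> \<Longrightarrow> \<exists>c. v = sc c delta"
    and simple: "rep.simple P (supported P)"
    and inf: "\<And>l::int. l \<noteq> 0 \<Longrightarrow> beta l \<notin> \<nu> ` H"
    and U: "rep.invariant L U" "U \<subseteq> supported L"
  shows "U = {0} \<or> U = supported L"
proof -
  have M_L: "M \<subseteq> L" using M_sub_P P_sub_L by blast
  have H_L: "H \<subseteq> L" using H_sub_P P_sub_L by blast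
  have iE: "rep.invariant L (supported L)" by (rule supported_invariant[OF subgroup_L])
  have "rep.invariant P (U \<inter> supported P)"
    using rep.invariant_mono[OF U(1) P_sub_L] supported_invariant[OF subgroup_P]
    by (rule rep.invariant_Int)
  then have "U \<inter> supported P = {0} \<or> U \<inter> supported P = supported P"
    using simple unfolding rep.simple_def by (metis Int_lower2)
  then show ?thesis
  proof
    assume "U \<inter> supported P = supported P"
    then have "delta \<in> U" using delta_in[OF H_sub_P] by blast
    then show ?thesis using supported_L_cyclic[OF U(1)] U(2) by blast
  next
    assume 0: "U \<inter> supported P = {0}"
    obtain p where p: "rep.equivariant M (supported L) p" "\<And>v. v \<in> supported L \<Longrightarrow> p v \<in> U"
      "\<And>u. u \<in> U \<Longrightarrow> p u = u"
      by (rule exists_M_projection[OF simple rep.invariant_mono[OF U(1) M_L] U(2)]) (rule that)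
    have d: "delta \<in> supported L" by (rule delta_in[OF H_L])
    have p0: "p (act (b [^] k) delta) = 0" for k :: int
    proof -
      define g where "g = b [^] k"
      have g: "g \<in> L" "g \<in> carrier G" "inv g \<in> L" "inv g \<in> carrier G"
        using b_pow_L b subgroup.m_inv_closed[OF subgroup_L b_pow_L] by (simp_all add: g_def)
      have gd: "act g delta \<in> supported L" using rep.invariantD(4)[OF iE g(1) d] .
      have pgU: "p (act g delta) \<in> U" by (rule p(2)[OF gd])
      then have pgi: "p (act g delta) \<in> ind" by (rule rep.invariantD(3)[OF U(1)])
      define u where "u = act (inv g) (p (act g delta))"
      have uU: "u \<in> U" unfolding u_def using rep.invariantD(4)[OF U(1) g(3) pgU] .
      have "act c u = sc (\<chi> c) u" if c: "c \<in> H" "c \<in> M" for c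
      proof -
        have cc: "c \<in> carrier G" using H_carrier[OF c(1)] .
        let ?c = "g \<otimes> c \<otimes> inv g"
        have cM: "?c \<in> M" using M_normal'[OF g(1) c(2)] .
        have "act c u = act (inv g) (act ?c (p (act g delta)))"
          unfolding u_def using rep.rep_conj[OF g(4) cc pgi] g(2) by simp
        also have "act ?c (p (act g delta)) = p (act ?c (act g delta))"
          using rep.equivariantD(3)[OF p(1) cM gd] by simp
        also have "act ?c (act g delta) = act g (act c delta)"
        proof -
          have "inv g \<otimes> ?c \<otimes> g = c"
            using g(2) cc by (metis inv_solve_left inv_solve_right m_assoc m_closed inv_closed)
          then show ?thesis using rep.rep_conj[OF g(2) subsetD[OF M_carrier cM] delta_ind] by simp
        qed
        also have "act g (act c delta) = sc (\<chi> c) (act g delta)"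
          using act_delta[OF c(1)] rep.scale[OF g(2) delta_ind] by simp
        also have "p (sc (\<chi> c) (act g delta)) = sc (\<chi> c) (p (act g delta))"
          by (rule rep.equivariantD(2)[OF p(1) gd])
        also have "act (inv g) (sc (\<chi> c) (p (act g delta))) = sc (\<chi> c) u"
          unfolding u_def by (rule rep.scale[OF g(4) pgi])
        finally show ?thesis .
      qed
      then have "u \<in> supported P"
        using eigenvector_supported_P[OF eig inf] U(2) uU by blast
      then have "u = 0" using 0 uU by blast
      then have "act g u = 0" using rep.rep_zero[OF g(2)] by simp
      then show "p (act (b [^] k) delta) = 0"
        unfolding u_def using rep.rep_inv(2)[OF g(2) pgi] by (simp add: g_def)
    qed
    let ?K = "{v \<in> supported L. p v = 0}"
    have "supported L \<subseteq> ?K"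
    proof (rule supported_L_subset[OF kernel_subspace[OF p(1) rep.invariantD(1)[OF iE]]])
      fix m and k :: int assume m: "m \<in> M"
      have bd: "act (b [^] k) delta \<in> supported L" using rep.invariantD(4)[OF iE b_pow_L d] .
      then have "act m (act (b [^] k) delta) \<in> supported L"
        using rep.invariantD(4)[OF iE] m M_L by blast
      moreover have "p (act m (act (b [^] k) delta)) = 0"
        using rep.equivariantD(3)[OF p(1) m bd] p0[of k] rep.rep_zero[OF subsetD[OF M_carrier m]] by simp
      ultimately show "act m (act (b [^] k) delta) \<in> ?K" by (intro CollectI conjI)
    qed
    then have "u = 0" if u: "u \<in> U" for u using U(2) u p(3)[OF u] by auto
    then show ?thesis using rep.invariantD(5)[OF U(1)] by blast
  qed
qed

proposition simple_step:
  assumes eig: "\<And>v. \<lbrakk>v \<in> ind; \<And>h. h \<in> H \<Longrightarrow> act h v = sc (\<chi> h) v\<rbrakk> \<Longrightarrow> \<exists>c. v = sc c delta"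
    and simple: "rep.simple P (supported P)"
  shows "rep.simple L (supported L)"
proof -
  have "delta \<in> supported L"
    using H_sub_P P_sub_L by (intro delta_in) blast
  moreover have "delta \<noteq> 0"
    using delta_one by (metis zero_fun_apply zero_neq_one)
  moreover have "U = {0} \<or> U = supported L" if "rep.invariant L U" "U \<subseteq> supported L" for U
  proof (cases "\<exists>l::int. l \<noteq> 0 \<and> beta l \<in> \<nu> ` H")
    case True
    then show ?thesis using irreducible_finite_index[OF eig simple _ _ that] by blast
  next
    case False
    then show ?thesis using irreducible_infinite_index[OF eig simple _ that] by blast
  qed
  ultimately show ?thesis
    using supported_invariant[OF subgroup_L] unfolding rep.simple_def by blast
qed

end

section \<open>Ascent along the supersolvable series\<close>

lemma (in induced_character) simple_supported_H: "rep.simple H (supported H)"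
proof -
  have sc: "f = sc (f \<one>) delta" if f: "f \<in> supported H" for f
  proof
    fix x
    have fi: "f \<in> ind" and f0: "\<And>x. x \<notin> H \<Longrightarrow> f x = 0" using f by (auto simp: supported_def)
    show "f x = sc (f \<one>) delta x"
      using f0[of x] indD(2)[OF fi, of x \<one>] H_carrier[of x]
      by (cases "x \<in> H") (simp_all add: pointwise_scale_def delta_def)
  qed
  have "U = {0} \<or> U = supported H" if U: "rep.invariant H U" "U \<subseteq> supported H" for U
  proof (cases "U = {0}")
    case False
    then obtain u where u: "u \<in> U" "u \<noteq> 0" using rep.invariantD(5)[OF U(1)] by blast
    have u1: "u = sc (u \<one>) delta" using sc U(2) u(1) by blast
    have "u \<one> \<noteq> 0"
    proof
      assume "u \<one> = 0"
      then have "u = 0" using u1 by (simp only: rep.scale_zero_left)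
      then show False using u(2) by simp
    qed
    have "f \<in> U" if f: "f \<in> supported H" for f
    proof -
      have "sc (f \<one> / u \<one>) u = sc (f \<one> / u \<one>) (sc (u \<one>) delta)"
        using u1 by (rule arg_cong)
      also have "\<dots> = sc (f \<one>) delta"
        using \<open>u \<one> \<noteq> 0\<close> by (simp only: rep.scale_scale nonzero_eq_divide_eq) simp
      also have "\<dots> = f" using sc[OF f] by (rule sym)
      finally show ?thesis using rep.invariantD(8)[OF U(1) u(1), of "f \<one> / u \<one>"]
        by (simp only:)
    qed
    then show ?thesis using U(2) by blast
  qed simp
  moreover have "delta \<noteq> 0"
    using delta_one by (metis zero_fun_apply zero_neq_one)
  ultimately show ?thesis
    using supported_invariant[OF subgroup_H] delta_supported unfolding rep.simple_def by blast
qed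

lemma (in group) cyclic_quotient_generator:
  assumes N: "N \<lhd> G" and J: "subgroup J G" and NJ: "N \<subseteq> J"
    and cyc: "cyclic_group ((G\<lparr>carrier := J\<rparr>) Mod N)"
  obtains b where "b \<in> J" "\<And>x. x \<in> J \<Longrightarrow> \<exists>k::int. N #> x = N #> b [^] k"
proof -
  let ?J = "G\<lparr>carrier := J\<rparr>"
  interpret NJ: normal N ?J
    using normal_restrict_supergroup[OF J N NJ] .
  interpret F: group "?J Mod N" by (rule NJ.factorgroup_is_group)
  have cos: "N #>\<^bsub>?J\<^esub> x = N #> x" for x by (simp add: r_coset_def)
  have carr: "carrier (?J Mod N) = (\<lambda>x. N #> x) ` J"
    by (simp add: carrier_FactGroup cos)
  obtain y where y: "y \<in> carrier (?J Mod N)" "carrier (?J Mod N) = range (\<lambda>n::int. y [^]\<^bsub>?J Mod N\<^esub> n)"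
    using cyc unfolding F.cyclic_group by blast
  obtain b where b: "b \<in> J" "y = N #> b" using y(1) unfolding carr by blast
  have pow: "y [^]\<^bsub>?J Mod N\<^esub> k = N #> b [^] k" for k :: int
    using NJ.FactGroup_int_pow[of b k] b int_pow_consistent[OF J b(1), of k] by (simp add: cos)
  show thesis
  proof
    show "b \<in> J" by (rule b(1))
    fix x assume "x \<in> J"
    then have "N #> x \<in> range (\<lambda>n::int. y [^]\<^bsub>?J Mod N\<^esub> n)" using y(2) carr by blast
    then show "\<exists>k::int. N #> x = N #> b [^] k" unfolding pow by blast
  qed
qed

lemma (in induced_character) simple_cyclic_extension:
  assumes eig: "\<And>v. \<lbrakk>v \<in> ind; \<And>h. h \<in> H \<Longrightarrow> act h v = sc (\<chi> h) v\<rbrakk> \<Longrightarrow> \<exists>c. v = sc c delta"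
    and N: "N \<lhd> G" and J: "J \<lhd> G" and NJ: "N \<subseteq> J"
    and cyc: "cyclic_group ((G\<lparr>carrier := J\<rparr>) Mod N)"
    and simple: "rep.simple (N <#> H) (supported (N <#> H))"
  shows "rep.simple (J <#> H) (supported (J <#> H))"
proof -
  interpret N: normal N G by (rule N)
  interpret J: normal J G by (rule J)
  obtain b where bJ: "b \<in> J" and gen: "\<And>x. x \<in> J \<Longrightarrow> \<exists>k::int. N #> x = N #> b [^] k"
    by (rule cyclic_quotient_generator[OF N J.subgroup_axioms NJ cyc]) (rule that)
  have bc: "b \<in> carrier G" using bJ J.subset by blast
  let ?\<nu> = "\<lambda>x. N #> x"
  interpret q: group_hom G "G Mod N" ?\<nu>
    by (rule group_hom.intro[OF group_axioms N.factorgroup_is_group])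
      (rule group_hom_axioms.intro[OF N.r_coset_hom_Mod])
  have gen': "\<exists>k::int. ?\<nu> x = ?\<nu> b [^]\<^bsub>G Mod N\<^esub> k" if "x \<in> J" for x
    using gen[OF that] q.hom_int_pow[OF bc] by simp
  interpret cyclic_step G H \<chi> "G Mod N" ?\<nu> b
  proof
    show "b \<in> carrier G" by (rule bc)
    fix h assume "h \<in> H"
    then have h: "h \<in> carrier G" by (rule H_carrier)
    have "h \<otimes> b \<otimes> inv h \<in> J" by (rule J.inv_op_closed2[OF h bJ])
    from gen'[OF this] show "\<exists>e::int. ?\<nu> h \<otimes>\<^bsub>G Mod N\<^esub> ?\<nu> b \<otimes>\<^bsub>G Mod N\<^esub> inv\<^bsub>G Mod N\<^esub> ?\<nu> h = ?\<nu> b [^]\<^bsub>G Mod N\<^esub> e"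
      using h bc by (simp del: mult_FactGroup)
  qed
  have coset: "x \<in> N #> y \<longleftrightarrow> N #> x = N #> y" if "x \<in> carrier G" "y \<in> carrier G" for x y
    using that repr_independence[OF _ _ N.subgroup_axioms, of x y] rcos_self[OF _ N.subgroup_axioms] by auto
  have "P = N <#> H"
  proof (intro equalityI subsetI)
    fix x assume "x \<in> P"
    then obtain h where h: "x \<in> carrier G" "h \<in> H" "N #> x = N #> h" by (auto simp: P_def)
    then have "x \<in> N #> h" using coset H_carrier by blast
    then show "x \<in> N <#> H" using h(2) by (auto simp: r_coset_def set_mult_def)
  next
    fix x assume "x \<in> N <#> H"
    then obtain n h where x: "n \<in> N" "h \<in> H" "x = n \<otimes> h" by (auto simp: set_mult_def)
    have "N #> x = N #> h"
      using coset[of x h] x H_carrier[OF x(2)] N.subset by (auto simp: r_coset_def)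
    then show "x \<in> P" using x H_carrier[OF x(2)] N.subset by (auto simp: P_def)
  qed
  moreover have "L = J <#> H"
  proof (intro equalityI subsetI)
    fix x assume "x \<in> L"
    then obtain k h where h: "x \<in> carrier G" "h \<in> H"
      "N #> x = ?\<nu> b [^]\<^bsub>G Mod N\<^esub> (k::int) \<otimes>\<^bsub>G Mod N\<^esub> ?\<nu> h"
      by (auto simp: L_def)
    have hc: "h \<in> carrier G" "b [^] k \<in> carrier G" using H_carrier[OF h(2)] bc by auto
    have "N #> x = ?\<nu> (b [^] k \<otimes> h)"
      using h(3) hc nu_b_pow[of k] q.hom_mult[OF hc(2,1)] by (simp del: mult_FactGroup)
    then have "x \<in> N #> (b [^] k \<otimes> h)" using coset[OF h(1)] hc by blast
    then obtain n where n: "n \<in> N" "x = n \<otimes> (b [^] k \<otimes> h)" by (auto simp: r_coset_def)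
    have "n \<otimes> b [^] k \<in> J"
      using n(1) NJ subgroup_int_pow_closed[OF J.subgroup_axioms bJ] by auto
    moreover have "x = (n \<otimes> b [^] k) \<otimes> h" using n N.subset hc by (auto simp: m_assoc)
    ultimately show "x \<in> J <#> H" using h(2) by (auto simp: set_mult_def)
  next
    fix x assume "x \<in> J <#> H"
    then obtain n h where x: "n \<in> J" "h \<in> H" "x = n \<otimes> h" by (auto simp: set_mult_def)
    have c: "n \<in> carrier G" "h \<in> carrier G" using x J.subset H_carrier by auto
    obtain k :: int where k: "?\<nu> n = ?\<nu> b [^]\<^bsub>G Mod N\<^esub> k" using gen'[OF x(1)] by blast
    have "?\<nu> x = ?\<nu> b [^]\<^bsub>G Mod N\<^esub> k \<otimes>\<^bsub>G Mod N\<^esub> ?\<nu> h"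
      using q.hom_mult[OF c] by (simp add: x(3) k del: mult_FactGroup)
    then show "x \<in> L" using x c unfolding L_def by blast
  qed
  ultimately show ?thesis using simple_step[OF eig] simple by simp
qed

theorem theorem1p3:
  fixes G :: "('g, 'x) monoid_scheme" and H :: "'g set" and \<chi> :: "'g \<Rightarrow> complex"
  assumes "supersolvable G"
    and "subgroup H G"
    and "\<chi> \<in> hom (G\<lparr>carrier := H\<rparr>) complex_units"
    and "schur_irreducible_rep G (pointwise_scale (*))
           (ind_space G H UNIV (char_action \<chi>)) (ind_action G)"
  shows "irreducible_rep G (pointwise_scale (*))
           (ind_space G H UNIV (char_action \<chi>)) (ind_action G)"
proof -
  have "group G" using assms(1) by (simp add: supersolvable_def)
  then interpret group G .
  interpret induced_character G H \<chi>
    using assms(2,3) by (intro induced_character.intro induced_character_axioms.intro group_axioms)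
  have eig: "\<exists>c. v = sc c delta" if "v \<in> ind" "\<And>h. h \<in> H \<Longrightarrow> act h v = sc (\<chi> h) v" for v
    using schur_eigenvector[OF schur_irreducible_rep.dim_End_G[OF assms(4)] that] .
  obtain k :: nat and N where N: "N 0 = carrier G" "N (Suc k) = {\<one>\<^bsub>G\<^esub>}"
    and normal: "\<forall>i\<le>Suc k. N i \<lhd> G"
    and cyclic: "\<forall>i\<le>k. N (Suc i) \<subseteq> N i \<and> cyclic_group ((G\<lparr>carrier := N i\<rparr>) Mod N (Suc i))"
    using assms(1) unfolding supersolvable_def by (elim conjE exE)
  have HG: "H \<subseteq> carrier G" using assms(2) by (rule subgroup.subset)
  \<comment> \<open>Upwards along the series, from the trivial group \<open>N (Suc k)\<close> to \<open>N 0 = G\<close>.\<close>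
  have "rep.simple (N 0 <#>\<^bsub>G\<^esub> H) (supported (N 0 <#>\<^bsub>G\<^esub> H))"
  proof (rule inc_induct[of 0 "Suc k" "\<lambda>i. rep.simple (N i <#>\<^bsub>G\<^esub> H) (supported (N i <#>\<^bsub>G\<^esub> H))"])
    have "N (Suc k) <#>\<^bsub>G\<^esub> H = H"
    proof (intro equalityI subsetI)
      fix x assume "x \<in> N (Suc k) <#>\<^bsub>G\<^esub> H"
      then show "x \<in> H" using HG unfolding N(2) set_mult_def by auto
    next
      fix x assume x: "x \<in> H"
      then have "x = \<one>\<^bsub>G\<^esub> \<otimes>\<^bsub>G\<^esub> x" using H_carrier by simp
      then show "x \<in> N (Suc k) <#>\<^bsub>G\<^esub> H" using x unfolding N(2) set_mult_def by blast
    qed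
    then show "rep.simple (N (Suc k) <#>\<^bsub>G\<^esub> H) (supported (N (Suc k) <#>\<^bsub>G\<^esub> H))"
      using simple_supported_H by (simp only:)
    fix i assume i: "i < Suc k"
      and IH: "rep.simple (N (Suc i) <#>\<^bsub>G\<^esub> H) (supported (N (Suc i) <#>\<^bsub>G\<^esub> H))"
    have "N (Suc i) \<lhd> G" "N i \<lhd> G" "N (Suc i) \<subseteq> N i"
      "cyclic_group ((G\<lparr>carrier := N i\<rparr>) Mod N (Suc i))"
      using i normal cyclic by simp_all
    from simple_cyclic_extension[OF _ this IH]
    show "rep.simple (N i <#>\<^bsub>G\<^esub> H) (supported (N i <#>\<^bsub>G\<^esub> H))"
      using eig by this
  qed simp
  moreover have "N 0 <#>\<^bsub>G\<^esub> H = carrier G"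
  proof
    show "N 0 <#>\<^bsub>G\<^esub> H \<subseteq> carrier G" using HG by (auto simp: N(1) set_mult_def)
    show "carrier G \<subseteq> N 0 <#>\<^bsub>G\<^esub> H"
    proof
      fix x assume x: "x \<in> carrier G"
      then have "x = x \<otimes>\<^bsub>G\<^esub> \<one>\<^bsub>G\<^esub>" by simp
      then show "x \<in> N 0 <#>\<^bsub>G\<^esub> H" using x H_closed(1) unfolding N(1) set_mult_def by blast
    qed
  qed
  ultimately have simple: "rep.simple (carrier G) ind" by (simp add: supported_carrier)
  show ?thesis
  proof (unfold_locales)
    show "ind \<noteq> {0}" using simple by (simp add: rep.simple_def)
    show "U = {0} \<or> U = ind"
      if "rep.subspace U" "U \<subseteq> ind" "\<And>g u. \<lbrakk>g \<in> carrier G; u \<in> U\<rbrakk> \<Longrightarrow> act g u \<in> U" for U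
      using simple that unfolding rep.simple_def rep.invariant_def by blast
  qed
qed

end
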